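(* Let $d\ge1$ and $K\ge2$ be integers. For any $\boldsymbol{A}=\{A_1,\dots,A_K\}\subset\mathbb{R}^{d\times d}$ and any $\mathbb{A}=(\mathbb{A}_{ij})\in\{0,1\}^{K\times K}$, $$\limsup_{n\to\infty}\ \max_{w\in W_{\mathrm{per}}^n(\mathbb{A})}\sqrt[n]{\rho(A_{w_n}\cdots A_{w_1})}\;=\;\lim_{n\to\infty}\ \max_{\sigma\in\varSigma_{\mathbb{A}}^+}\sqrt[n]{\|A_{\sigma(n)}\cdots A_{\sigma(1)}\|}.$$
   Context: $\|\cdot\|$ is the matrix norm induced by any fixed vector norm on $\mathbb{R}^d$; $\rho(B)$ is the spectral radius of a matrix $B$. $\varSigma_{\mathbb{A}}^+$ is the set of all sequences $\sigma\colon\mathbb{N}=\{1,2,\dots\}\to\{1,\dots,K\}$ with $\mathbb{A}_{\sigma(n)\sigma(n+1)}=1$ for all $n\ge1$. For $n\ge1$, $W_{\mathrm{per}}^n(\mathbb{A})$ is the set of words $w=(w_1,\dots,w_n)\in\{1,\dots,K\}^n$ with $\mathbb{A}_{w_kw_{k+1}}=1$ for $1\le k<n$ and $\mathbb{A}_{w_nw_1}=1$. A maximum over an empty set is taken to be $0$. *)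

theory Defs
  imports Complex_Main "HOL-Library.FuncSet" "HOL-Library.Extended_Real"
    "Jordan_Normal_Form.Spectral_Radius"
begin

definition vec_norm_on :: "nat \<Rightarrow> (real vec \<Rightarrow> real) \<Rightarrow> bool" where
  "vec_norm_on d N \<longleftrightarrow>
     (\<forall>v \<in> carrier_vec d. 0 \<le> N v) \<and>
     (\<forall>v \<in> carrier_vec d. N v = 0 \<longleftrightarrow> v = 0\<^sub>v d) \<and>
     (\<forall>c. \<forall>v \<in> carrier_vec d. N (c \<cdot>\<^sub>v v) = \<bar>c\<bar> * N v) \<and>
     (\<forall>v \<in> carrier_vec d. \<forall>w \<in> carrier_vec d. N (v + w) \<le> N v + N w)"

definition induced_norm :: "nat \<Rightarrow> (real vec \<Rightarrow> real) \<Rightarrow> real mat \<Rightarrow> real" where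
  "induced_norm d N B = (SUP v \<in> {v \<in> carrier_vec d. N v = 1}. N (B *\<^sub>v v))"

(* The library's spectral radius is for complex matrices: the eigenvalues of a real
   matrix are taken over the complex numbers. *)
definition real_spectral_radius :: "real mat \<Rightarrow> real" where
  "real_spectral_radius B = spectral_radius (map_mat complex_of_real B)"

(* Words and sequences are both functions with indices starting at 1;
   word_prod d A u n = A (u n) * ... * A (u 1), of dimension d. *)
fun word_prod :: "nat \<Rightarrow> (nat \<Rightarrow> real mat) \<Rightarrow> (nat \<Rightarrow> nat) \<Rightarrow> nat \<Rightarrow> real mat" where
  "word_prod d A u 0 = 1\<^sub>m d"
| "word_prod d A u (Suc n) = A (u (Suc n)) * word_prod d A u n"

(* Only the entries T i j with i, j in {1..K} matter. *)
definition zero_one_matrix :: "nat \<Rightarrow> (nat \<Rightarrow> nat \<Rightarrow> nat) \<Rightarrow> bool" where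
  "zero_one_matrix K T \<longleftrightarrow> (\<forall>i \<in> {1..K}. \<forall>j \<in> {1..K}. T i j \<in> {0, 1})"

definition markov_seqs :: "nat \<Rightarrow> (nat \<Rightarrow> nat \<Rightarrow> nat) \<Rightarrow> (nat \<Rightarrow> nat) set" where
  "markov_seqs K T = {\<sigma> \<in> {1..} \<rightarrow>\<^sub>E {1..K}. \<forall>n\<ge>1. T (\<sigma> n) (\<sigma> (n + 1)) = 1}"

definition periodic_words :: "nat \<Rightarrow> (nat \<Rightarrow> nat \<Rightarrow> nat) \<Rightarrow> nat \<Rightarrow> (nat \<Rightarrow> nat) set" where
  "periodic_words K T n = {w \<in> {1..n} \<rightarrow>\<^sub>E {1..K}.
     (\<forall>k. 1 \<le> k \<and> k < n \<longrightarrow> T (w k) (w (k + 1)) = 1) \<and> T (w n) (w 1) = 1}"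

(* The set of sequences may be infinite, but the sets of values whose maximum is taken
   below are finite, since the values depend only on the first n letters. *)
definition max_or_0 :: "real set \<Rightarrow> real" where
  "max_or_0 S = (if S = {} then 0 else Max S)"

definition max_spectral ::
    "nat \<Rightarrow> nat \<Rightarrow> (nat \<Rightarrow> real mat) \<Rightarrow> (nat \<Rightarrow> nat \<Rightarrow> nat) \<Rightarrow> nat \<Rightarrow> real" where
  "max_spectral d K A T n =
     max_or_0 ((\<lambda>w. root n (real_spectral_radius (word_prod d A w n))) ` periodic_words K T n)"

definition max_norm ::
    "nat \<Rightarrow> (real vec \<Rightarrow> real) \<Rightarrow> nat \<Rightarrow> (nat \<Rightarrow> real mat) \<Rightarrow> (nat \<Rightarrow> nat \<Rightarrow> nat) \<Rightarrow> nat \<Rightarrow> real" where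
  "max_norm d N K A T n =
     max_or_0 ((\<lambda>\<sigma>. root n (induced_norm d N (word_prod d A \<sigma> n))) ` markov_seqs K T)"

end

theory Submission imports Defs begin

text \<open>Let \<open>L\<close> be the limit of the norms; it exists by submultiplicativity, and it bounds the spectral side because an eigenvalue of a periodic word gives geometric growth along its repetitions. For the converse suppose \<open>L > 0\<close> and take \<open>g\<close> slightly larger than \<open>L\<close>. For each state \<open>s\<close> the supremum of \<open>N (A\<^sub>w x) / g\<^sup>n\<close> over the admissible words \<open>w\<close> of length \<open>n\<close> starting in \<open>s\<close> is a norm, and with respect to these norms no admissible step expands by more than \<open>g\<close>. Since the growth rate is \<open>L\<close>, some path stays within a constant factor of \<open>L\<^sup>k\<close> for a prescribed number of steps. Balls in \<open>d\<close>-dimensional normed spaces are totally bounded uniformly in the norm, so this path nearly returns to a previous state and direction. By the Cayley-Hamilton theorem the loop it closes has, after rescaling, an eigenvalue that is near 1 or of modulus greater than 1. Working with \<open>g > L\<close> instead of an extremal norm avoids any reduction to irreducible families.\<close>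

section \<open>Characteristic polynomials\<close>

text \<open>Cayley-Hamilton along an orbit, coordinate by coordinate and without matrix powers. Row
  \<open>i\<close> of the identity adj(x - A) (x - A) = char_poly(A) is compared coefficientwise in
  x (\<open>rel\<close>); pairing the k-th relation with \<open>y k\<close> makes the sum
  telescope.\<close>

lemma char_poly_annihilates:
  fixes A :: "'a::comm_ring_1 mat" and y :: "nat \<Rightarrow> 'a vec"
  assumes A: "A \<in> carrier_mat d d"
    and y: "\<And>k. y k \<in> carrier_vec d" "\<And>k. y (Suc k) = A *\<^sub>v y k"
    and i: "i < d"
  shows "(\<Sum>k\<le>d. coeff (char_poly A) k * y k $ i) = 0"
proof -
  define M where "M = char_poly_matrix A"
  define B where "B = adj_mat M"
  have M: "M \<in> carrier_mat d d" using A by (simp add: M_def)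
  note B = adj_mat[OF M, folded B_def]
  have M_entry: "M $$ (l, j) = (if l = j then [:0, 1:] else 0) - [:A $$ (l, j):]"
    if "l < d" "j < d" for l j
    using that A by (auto simp: M_def char_poly_matrix_def)
  define b where "b j k = coeff (B $$ (i, j)) k" for j k
  have rel: "(case k of 0 \<Rightarrow> 0 | Suc k' \<Rightarrow> b j k') - (\<Sum>l<d. b l k * A $$ (l, j))
      = (if j = i then coeff (char_poly A) k else 0)" if j: "j < d" for j k
  proof -
    have "(B * M) $$ (i, j) = (\<Sum>l<d. B $$ (i, l) * M $$ (l, j))"
      using B(1) M i j by (simp add: scalar_prod_def atLeast0LessThan)
    also have "\<dots> = (\<Sum>l<d. (if l = j then [:0, 1:] * B $$ (i, j) else 0)
        - Polynomial.smult (A $$ (l, j)) (B $$ (i, l)))"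
      using j by (intro sum.cong refl) (auto simp: M_entry algebra_simps)
    also have "\<dots> = [:0, 1:] * B $$ (i, j) - (\<Sum>l<d. Polynomial.smult (A $$ (l, j)) (B $$ (i, l)))"
      using j by (simp add: sum_subtractf)
    finally have e: "(B * M) $$ (i, j)
        = [:0, 1:] * B $$ (i, j) - (\<Sum>l<d. Polynomial.smult (A $$ (l, j)) (B $$ (i, l)))" .
    have "(B * M) $$ (i, j) = (if j = i then char_poly A else 0)"
      unfolding B(3) using i j M by (simp add: char_poly_def M_def)
    with e have "coeff ([:0, 1:] * B $$ (i, j) - (\<Sum>l<d. Polynomial.smult (A $$ (l, j)) (B $$ (i, l)))) k
        = coeff (if j = i then char_poly A else 0) k" by simp
    then show ?thesis
      by (auto simp: coeff_sum b_def coeff_pCons mult.commute split: nat.splits)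
  qed
  \<comment> \<open>Since \<open>y (Suc k)\<close> is \<open>A\<close> applied to
    \<open>y k\<close>, the term containing \<open>A\<close> in the k-th relation pairs to
    \<open>z k\<close> and the shifted term to \<open>z (k - 1)\<close>.\<close>
  define z where "z k = (\<Sum>j<d. b j k * y (Suc k) $ j)" for k
  have yS: "y (Suc k) $ l = (\<Sum>j<d. A $$ (l, j) * y k $ j)" if "l < d" for k l
    using that A y(1)[of k] by (simp add: y(2) scalar_prod_def atLeast0LessThan)
  have step: "coeff (char_poly A) k * y k $ i = (case k of 0 \<Rightarrow> 0 | Suc k' \<Rightarrow> z k') - z k" for k
  proof -
    have "coeff (char_poly A) k * y k $ i
        = (\<Sum>j<d. (if j = i then coeff (char_poly A) k else 0) * y k $ j)"
      using i by (subst sum.cong[OF refl, of _ _ "\<lambda>j. if j = i then coeff (char_poly A) k * y k $ i else 0"])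
        auto
    also have "\<dots> = (\<Sum>j<d. ((case k of 0 \<Rightarrow> 0 | Suc k' \<Rightarrow> b j k')
        - (\<Sum>l<d. b l k * A $$ (l, j))) * y k $ j)"
      by (intro sum.cong refl) (simp add: rel)
    also have "\<dots> = (\<Sum>j<d. (case k of 0 \<Rightarrow> 0 | Suc k' \<Rightarrow> b j k') * y k $ j)
        - (\<Sum>j<d. \<Sum>l<d. b l k * A $$ (l, j) * y k $ j)"
      by (simp add: left_diff_distrib sum_subtractf sum_distrib_right)
    also have "(\<Sum>j<d. \<Sum>l<d. b l k * A $$ (l, j) * y k $ j) = z k"
      by (subst sum.swap) (simp add: z_def yS sum_distrib_left mult.assoc)
    also have "(\<Sum>j<d. (case k of 0 \<Rightarrow> 0 | Suc k' \<Rightarrow> b j k') * y k $ j)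
        = (case k of 0 \<Rightarrow> 0 | Suc k' \<Rightarrow> z k')"
      by (cases k) (simp_all add: z_def)
    finally show ?thesis .
  qed
  have tele: "(\<Sum>k\<le>m. coeff (char_poly A) k * y k $ i) = - z m" for m
    by (induction m) (simp_all add: step)
  \<comment> \<open>Beyond the degrees of all entries in row \<open>i\<close> the remainder
    \<open>z m\<close> vanishes; the summand \<open>d\<close> ensures that the sum up to
    \<open>m\<close> covers all indices up to \<open>d\<close>.\<close>
  define m where "m = d + (\<Sum>j<d. degree (B $$ (i, j)) + 1)"
  have "b j m = 0" if "j < d" for j
  proof -
    have "degree (B $$ (i, j)) + 1 \<le> (\<Sum>j<d. degree (B $$ (i, j)) + 1)"
      by (rule member_le_sum) (use that in auto)
    then show ?thesis by (simp add: b_def m_def coeff_eq_0)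
  qed
  then have "(\<Sum>k\<le>m. coeff (char_poly A) k * y k $ i) = 0"
    by (simp add: tele z_def)
  moreover have "(\<Sum>k\<le>m. coeff (char_poly A) k * y k $ i)
      = (\<Sum>k\<le>d. coeff (char_poly A) k * y k $ i)"
    using degree_monic_char_poly[OF A]
    by (intro sum.mono_neutral_right) (auto simp: m_def coeff_eq_0)
  ultimately show ?thesis by simp
qed

text \<open>Multiplication by x - a shifts the polynomial and subtracts a times it, so for |a| <= 1
  the bound on the coefficients at most doubles.\<close>

lemma coeff_prod_linear_le:
  fixes as :: "'a::{real_normed_field} list"
  assumes "\<And>a. a \<in> set as \<Longrightarrow> norm a \<le> 1"
  shows "norm (coeff (\<Prod>a\<leftarrow>as. [:- a, 1:]) k) \<le> 2 ^ length as"
  using assms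
proof (induction as arbitrary: k)
  case Nil
  then show ?case by (simp add: coeff_pCons split: nat.split)
next
  case (Cons a as)
  let ?p = "\<Prod>a\<leftarrow>as. [:- a, 1:]"
  have b: "norm (coeff ?p k) \<le> 2 ^ length as" for k
    using Cons by simp
  have "norm (a * coeff ?p k) \<le> 1 * 2 ^ length as"
    unfolding norm_mult by (intro mult_mono b) (use Cons.prems in auto)
  moreover have "norm (case k of 0 \<Rightarrow> 0 | Suc l \<Rightarrow> coeff ?p l) \<le> 2 ^ length as"
    using b by (cases k) auto
  moreover have "coeff (\<Prod>a\<leftarrow>a # as. [:- a, 1:]) k
      = (case k of 0 \<Rightarrow> 0 | Suc l \<Rightarrow> coeff ?p l) - a * coeff ?p k"
    by (simp add: coeff_pCons split: nat.split)
  ultimately show ?case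
    using norm_triangle_ineq4[of "case k of 0 \<Rightarrow> 0 | Suc l \<Rightarrow> coeff ?p l" "a * coeff ?p k"]
    by simp
qed

section \<open>Seminorms on coordinate spaces\<close>

text \<open>This notion is closed under composition with arbitrary, also singular, matrices;
  nonnegativity is derived in \<open>seminorm_nonneg\<close>.\<close>

definition seminorm_on :: "nat \<Rightarrow> (real vec \<Rightarrow> real) \<Rightarrow> bool" where
  "seminorm_on d q \<longleftrightarrow>
     (\<forall>c. \<forall>v \<in> carrier_vec d. q (c \<cdot>\<^sub>v v) = \<bar>c\<bar> * q v) \<and>
     (\<forall>v \<in> carrier_vec d. \<forall>w \<in> carrier_vec d. q (v + w) \<le> q v + q w)"

lemma vec_norm_on_imp_seminorm_on: "vec_norm_on d N \<Longrightarrow> seminorm_on d N"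
  by (simp add: vec_norm_on_def seminorm_on_def)

context
  fixes d :: nat and q :: "real vec \<Rightarrow> real"
  assumes q: "seminorm_on d q"
begin

lemma seminorm_smult: "v \<in> carrier_vec d \<Longrightarrow> q (c \<cdot>\<^sub>v v) = \<bar>c\<bar> * q v"
  using q by (simp add: seminorm_on_def)

lemma seminorm_add:
  "v \<in> carrier_vec d \<Longrightarrow> w \<in> carrier_vec d \<Longrightarrow> q (v + w) \<le> q v + q w"
  using q by (simp add: seminorm_on_def)

lemma seminorm_zero: "q (0\<^sub>v d) = 0"
proof -
  have "(0::real) \<cdot>\<^sub>v 0\<^sub>v d = 0\<^sub>v d" by auto
  then show ?thesis using seminorm_smult[of "0\<^sub>v d" 0] by simp
qed

lemma seminorm_diff:
  assumes "v \<in> carrier_vec d" "w \<in> carrier_vec d"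
  shows "q (v - w) \<le> q v + q w"
proof -
  have "v - w = v + (-1) \<cdot>\<^sub>v w" using assms by (intro eq_vecI) auto
  then show ?thesis using seminorm_add[of v "(-1) \<cdot>\<^sub>v w"] seminorm_smult[of w "-1"] assms by simp
qed

lemma seminorm_nonneg:
  assumes "v \<in> carrier_vec d"
  shows "0 \<le> q v"
  using seminorm_diff[OF assms assms] assms by (simp add: seminorm_zero)

lemma seminorm_minus_commute:
  assumes "v \<in> carrier_vec d" "w \<in> carrier_vec d"
  shows "q (v - w) = q (w - v)"
proof -
  have "v - w = (-1) \<cdot>\<^sub>v (w - v)" using assms by (intro eq_vecI) auto
  then show ?thesis using seminorm_smult[of "w - v" "-1"] assms by simp
qed

lemma seminorm_linear_combination:
  assumes "finite J" "\<And>k. k \<in> J \<Longrightarrow> w k \<in> carrier_vec d"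
  shows "q (vec d (\<lambda>i. \<Sum>k\<in>J. c k * w k $ i)) \<le> (\<Sum>k\<in>J. \<bar>c k\<bar> * q (w k))"
  using assms
proof (induction J rule: finite_induct)
  case empty
  have "vec d (\<lambda>i. \<Sum>k\<in>{}. c k * w k $ i) = 0\<^sub>v d" by (intro eq_vecI) auto
  then show ?case by (simp add: seminorm_zero)
next
  case (insert k J)
  have wk: "w k \<in> carrier_vec d" using insert by simp
  have "vec d (\<lambda>i. \<Sum>k\<in>insert k J. c k * w k $ i)
      = c k \<cdot>\<^sub>v w k + vec d (\<lambda>i. \<Sum>k\<in>J. c k * w k $ i)"
    using insert.hyps carrier_vecD[OF wk] by (intro eq_vecI) auto
  then have "q (vec d (\<lambda>i. \<Sum>k\<in>insert k J. c k * w k $ i))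
      \<le> \<bar>c k\<bar> * q (w k) + q (vec d (\<lambda>i. \<Sum>k\<in>J. c k * w k $ i))"
    using seminorm_add[of "c k \<cdot>\<^sub>v w k" "vec d (\<lambda>i. \<Sum>k\<in>J. c k * w k $ i)"]
      seminorm_smult[OF wk, of "c k"] wk by simp
  with insert show ?case by simp
qed

lemma seminorm_le_sum:
  assumes v: "v \<in> carrier_vec d"
  shows "q v \<le> (\<Sum>j<d. \<bar>v $ j\<bar> * q (unit_vec d j))"
proof -
  have "v = vec d (\<lambda>i. \<Sum>j<d. v $ j * unit_vec d j $ i)"
  proof (intro eq_vecI)
    fix i assume i: "i < dim_vec (vec d (\<lambda>i. \<Sum>j<d. v $ j * unit_vec d j $ i))"
    have "(\<Sum>j<d. v $ j * unit_vec d j $ i) = (\<Sum>j<d. if j = i then v $ i else 0)"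
      using i by (intro sum.cong) (auto simp: unit_vec_def)
    then show "v $ i = vec d (\<lambda>i. \<Sum>j<d. v $ j * unit_vec d j $ i) $ i"
      using i by simp
  qed (use v in auto)
  then show ?thesis
    using seminorm_linear_combination[of "{..<d}" "unit_vec d" "\<lambda>j. v $ j"] by simp
qed

end

section \<open>Comparison of norms in finite dimension\<close>

text \<open>Induction on the number \<open>n\<close> of leading coordinates that may be nonzero: the
  next unit vector has positive distance from the span of the earlier ones, and this distance
  controls the new coordinate.\<close>

lemma norm_bounds_coordinates_aux:
  assumes N: "vec_norm_on d N" and n: "n \<le> d"
  shows "\<exists>c>0. \<forall>v \<in> carrier_vec d. (\<forall>i. n \<le> i \<and> i < d \<longrightarrow> v $ i = 0) \<longrightarrow>
           (\<forall>i<n. c * \<bar>v $ i\<bar> \<le> N v)"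
  using n
proof (induction n)
  case 0
  show ?case by (intro exI[of _ 1]) simp
next
  case (Suc n)
  note q = vec_norm_on_imp_seminorm_on[OF N]
  from Suc obtain c where c: "c > 0" and
    IH: "\<And>v i. v \<in> carrier_vec d \<Longrightarrow> \<forall>i. n \<le> i \<and> i < d \<longrightarrow> v $ i = 0 \<Longrightarrow> i < n
      \<Longrightarrow> c * \<bar>v $ i\<bar> \<le> N v" by auto
  define e where "e = (unit_vec d n :: real vec)"
  have e: "e \<in> carrier_vec d" by (simp add: e_def)
  define Y where "Y = {y \<in> carrier_vec d. \<forall>i. n \<le> i \<and> i < d \<longrightarrow> y $ i = (0::real)}"
  \<comment> \<open>Were the distance 0, near minimizers \<open>y k\<close> would be Cauchy in each
    coordinate by the induction hypothesis, and their limit \<open>z\<close> would give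
    \<open>N (e + z) = 0\<close>, although coordinate \<open>n\<close> of \<open>e + z\<close> is
    1.\<close>
  have "\<exists>\<delta>>0. \<forall>y\<in>Y. \<delta> \<le> N (e + y)"
  proof (rule ccontr)
    assume "\<not> ?thesis"
    then have "\<forall>k::nat. \<exists>y\<in>Y. N (e + y) < 1 / real (Suc k)"
      by (metis not_le zero_less_divide_1_iff of_nat_0_less_iff zero_less_Suc)
    then obtain y where y: "\<And>k. y k \<in> Y" and small: "\<And>k. N (e + y k) < 1 / real (Suc k)"
      by metis
    have yc: "y k \<in> carrier_vec d" for k using y by (auto simp: Y_def)
    have "Cauchy (\<lambda>k. y k $ i)" if i: "i < n" for i
    proof (rule metric_CauchyI)
      fix \<epsilon> :: real assume \<epsilon>: "\<epsilon> > 0"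
      obtain m where m: "2 / (c * \<epsilon>) < real m" using reals_Archimedean2 by blast
      have "0 < 2 / (c * \<epsilon>)" using c \<epsilon> by simp
      then have mpos: "real m > 0" using m by linarith
      have "dist (y k $ i) (y l $ i) < \<epsilon>" if kl: "k \<ge> m" "l \<ge> m" for k l
      proof -
        have "c * \<bar>(y k - y l) $ i\<bar> \<le> N (y k - y l)"
          using y[of k] y[of l] i by (intro IH) (auto simp: Y_def)
        also have "N (y k - y l) = N ((e + y k) - (e + y l))"
          using yc[of k] yc[of l] e by (intro arg_cong[of _ _ N] eq_vecI) auto
        also have "\<dots> \<le> N (e + y k) + N (e + y l)"
          using yc e by (intro seminorm_diff[OF q]) auto
        also have "\<dots> < 1 / real (Suc k) + 1 / real (Suc l)"
          using small[of k] small[of l] by linarith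
        also have "\<dots> \<le> 1 / real m + 1 / real m"
          using kl mpos by (intro add_mono divide_left_mono) auto
        also have "\<dots> < c * \<epsilon>"
          using m mpos c \<epsilon> by (simp add: field_simps)
        finally have "\<bar>(y k - y l) $ i\<bar> < \<epsilon>" using c by simp
        then show ?thesis
          using yc[of k] yc[of l] i Suc.prems by (simp add: dist_real_def)
      qed
      then show "\<exists>M. \<forall>m\<ge>M. \<forall>n\<ge>M. dist (y m $ i) (y n $ i) < \<epsilon>" by blast
    qed
    then have "\<forall>i. \<exists>l. i < n \<longrightarrow> (\<lambda>k. y k $ i) \<longlonglongrightarrow> l"
      using Cauchy_convergent convergent_def by blast
    then obtain l where l: "\<And>i. i < n \<Longrightarrow> (\<lambda>k. y k $ i) \<longlonglongrightarrow> l i" by metis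
    define z where "z = vec d (\<lambda>i. if i < n then l i else 0)"
    have z: "z \<in> carrier_vec d" by (simp add: z_def)
    have lim_coord: "(\<lambda>k. \<bar>(z - y k) $ i\<bar> * N (unit_vec d i)) \<longlonglongrightarrow> \<bar>0\<bar> * N (unit_vec d i)"
      if i: "i < d" for i
    proof (intro tendsto_intros)
      have "(\<lambda>k. z $ i - y k $ i) \<longlonglongrightarrow> 0"
      proof (cases "i < n")
        case True
        then show ?thesis using tendsto_diff[OF tendsto_const[of "l i"] l[of i]] i
          by (simp add: z_def)
      next
        case False
        then show ?thesis using y i by (simp add: z_def Y_def)
      qed
      moreover have "(z - y k) $ i = z $ i - y k $ i" for k
        using i carrier_vecD[OF yc[of k]] by simp
      ultimately show "(\<lambda>k. (z - y k) $ i) \<longlonglongrightarrow> 0" by simp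
    qed
    \<comment> \<open>This takes the place of continuity of \<open>N\<close>: the error is bounded
      by the coordinate errors, which tend to 0.\<close>
    have "N (e + z) \<le> 1 / real (Suc k) + (\<Sum>i<d. \<bar>(z - y k) $ i\<bar> * N (unit_vec d i))" for k
    proof -
      have "e + z = (e + y k) + (z - y k)"
        using yc[of k] e z by (intro eq_vecI) auto
      then have "N (e + z) \<le> N (e + y k) + N (z - y k)"
        using seminorm_add[OF q, of "e + y k" "z - y k"] yc e z by simp
      moreover have "N (z - y k) \<le> (\<Sum>i<d. \<bar>(z - y k) $ i\<bar> * N (unit_vec d i))"
        using yc z by (intro seminorm_le_sum[OF q]) simp
      ultimately show ?thesis using small[of k] by linarith
    qed
    moreover have "(\<lambda>k. 1 / real (Suc k) + (\<Sum>i<d. \<bar>(z - y k) $ i\<bar> * N (unit_vec d i)))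
        \<longlonglongrightarrow> 0 + (\<Sum>i<d. \<bar>0\<bar> * N (unit_vec d i))"
      using LIMSEQ_inverse_real_of_nat lim_coord
      by (intro tendsto_add tendsto_sum) (auto simp: inverse_eq_divide)
    ultimately have "N (e + z) \<le> 0 + (\<Sum>i<d. \<bar>0\<bar> * N (unit_vec d i))"
      by (intro LIMSEQ_le_const) auto
    then have "N (e + z) = 0"
      using seminorm_nonneg[OF q, of "e + z"] e z by simp
    then have "e + z = 0\<^sub>v d"
      using N e z by (simp add: vec_norm_on_def)
    then have "(e + z) $ n = 0" using Suc.prems by simp
    then show False using Suc.prems e z by (simp add: e_def z_def)
  qed
  then obtain \<delta> where \<delta>: "\<delta> > 0" and far: "\<And>y. y \<in> Y \<Longrightarrow> \<delta> \<le> N (e + y)" by blast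
  \<comment> \<open>Coordinate \<open>n\<close> is bounded through \<open>\<delta>\<close>, the
    earlier ones through \<open>c\<close> applied to \<open>y = v - t e\<close>, whose norm is at
    most \<open>1 + N e / \<delta>\<close> times that of \<open>v\<close>.\<close>
  define c' where "c' = min \<delta> (c / (1 + N e / \<delta>))"
  have Ne: "N e \<ge> 0" using seminorm_nonneg[OF q e] .
  then have den: "1 + N e / \<delta> > 0" using \<delta> by (smt (verit) divide_nonneg_pos)
  have "c' > 0" using \<delta> c den by (simp add: c'_def)
  moreover have "c' * \<bar>v $ i\<bar> \<le> N v"
    if v: "v \<in> carrier_vec d" and supp: "\<forall>i. Suc n \<le> i \<and> i < d \<longrightarrow> v $ i = 0"
      and i: "i < Suc n" for v i
  proof -
    define t where "t = v $ n"
    define y where "y = v - t \<cdot>\<^sub>v e"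
    have y: "y \<in> Y" using v e supp Suc.prems
      by (auto simp: Y_def y_def t_def e_def unit_vec_def)
    have yc: "y \<in> carrier_vec d" using y by (simp add: Y_def)
    have t: "\<delta> * \<bar>t\<bar> \<le> N v"
    proof (cases "t = 0")
      case True
      then show ?thesis using seminorm_nonneg[OF q v] by simp
    next
      case False
      have "(1 / t) \<cdot>\<^sub>v y \<in> Y" using y by (auto simp: Y_def)
      then have "\<delta> \<le> N (e + (1 / t) \<cdot>\<^sub>v y)" by (rule far)
      then have "\<delta> * \<bar>t\<bar> \<le> \<bar>t\<bar> * N (e + (1 / t) \<cdot>\<^sub>v y)"
        using False by (simp add: mult.commute mult_left_mono)
      also have "\<dots> = N (t \<cdot>\<^sub>v (e + (1 / t) \<cdot>\<^sub>v y))"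
        using seminorm_smult[OF q, of "e + (1 / t) \<cdot>\<^sub>v y" t] e yc by simp
      also have "t \<cdot>\<^sub>v (e + (1 / t) \<cdot>\<^sub>v y) = v"
        using False v e by (intro eq_vecI) (auto simp: y_def field_simps)
      finally show ?thesis .
    qed
    show ?thesis
    proof (cases "i = n")
      case True
      have "c' * \<bar>v $ i\<bar> \<le> \<delta> * \<bar>t\<bar>" using True by (simp add: c'_def t_def mult_right_mono)
      with t show ?thesis by linarith
    next
      case False
      then have "c * \<bar>v $ i\<bar> = c * \<bar>y $ i\<bar>"
        using i v e Suc.prems by (simp add: y_def e_def)
      also have "\<dots> \<le> N y"
        using y i False by (intro IH) (auto simp: Y_def)
      also have "\<dots> \<le> N v + \<bar>t\<bar> * N e"
        using seminorm_diff[OF q v, of "t \<cdot>\<^sub>v e"] seminorm_smult[OF q e, of t] e by (simp add: y_def)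
      also have "\<bar>t\<bar> * N e \<le> (N v / \<delta>) * N e"
        using t \<delta> Ne by (intro mult_right_mono) (auto simp: field_simps)
      also have "N v + (N v / \<delta>) * N e = N v * (1 + N e / \<delta>)" by (simp add: algebra_simps)
      finally have "(c / (1 + N e / \<delta>)) * \<bar>v $ i\<bar> \<le> N v"
        using den by (simp add: field_simps)
      moreover have "c' * \<bar>v $ i\<bar> \<le> (c / (1 + N e / \<delta>)) * \<bar>v $ i\<bar>"
        by (intro mult_right_mono) (auto simp: c'_def)
      ultimately show ?thesis by linarith
    qed
  qed
  ultimately show ?case by blast
qed

lemma norm_bounds_coordinates:
  assumes "vec_norm_on d N"
  shows "\<exists>c>0. \<forall>v \<in> carrier_vec d. \<forall>i<d. c * \<bar>v $ i\<bar> \<le> N v"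
  using norm_bounds_coordinates_aux[OF assms order_refl] by force

text \<open>Expand in unit vectors and bound the coordinates by \<open>N\<close>. Among other things
  this makes the supremum in \<open>induced_norm\<close> finite.\<close>

lemma seminorm_le_norm:
  assumes N: "vec_norm_on d N" and q: "seminorm_on d q"
  shows "\<exists>C\<ge>0. \<forall>v \<in> carrier_vec d. q v \<le> C * N v"
proof -
  from norm_bounds_coordinates[OF N] obtain c
    where c: "c > 0" "\<And>v i. v \<in> carrier_vec d \<Longrightarrow> i < d \<Longrightarrow> c * \<bar>v $ i\<bar> \<le> N v" by blast
  define C where "C = (\<Sum>i<d. q (unit_vec d i)) / c"
  have nn: "q (unit_vec d i) \<ge> 0" for i by (intro seminorm_nonneg[OF q]) simp
  have "q v \<le> C * N v" if v: "v \<in> carrier_vec d" for v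
  proof -
    have "q v \<le> (\<Sum>j<d. \<bar>v $ j\<bar> * q (unit_vec d j))" by (rule seminorm_le_sum[OF q v])
    also have "\<dots> \<le> (\<Sum>j<d. N v / c * q (unit_vec d j))"
      using c v nn by (intro sum_mono mult_right_mono) (auto simp: field_simps)
    also have "\<dots> = C * N v" by (simp add: C_def sum_distrib_left sum_distrib_right sum_divide_distrib mult.commute)
    finally show ?thesis .
  qed
  moreover have "C \<ge> 0" using nn c by (simp add: C_def sum_nonneg)
  ultimately show ?thesis by blast
qed

lemma seminorm_on_mult_mat_vec:
  assumes q: "seminorm_on d q" and B: "B \<in> carrier_mat d d"
  shows "seminorm_on d (\<lambda>v. q (B *\<^sub>v v))"
proof -
  have "B *\<^sub>v (c \<cdot>\<^sub>v v) = c \<cdot>\<^sub>v (B *\<^sub>v v)" if "v \<in> carrier_vec d" for c :: real and v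
    using B that by (intro mult_mat_vec)
  moreover have "B *\<^sub>v (v + w) = B *\<^sub>v v + B *\<^sub>v w"
    if "v \<in> carrier_vec d" "w \<in> carrier_vec d" for v w
    using B that by (intro mult_add_distrib_mat_vec)
  ultimately show ?thesis using q B by (simp add: seminorm_on_def)
qed

section \<open>Almost returning vectors and almost fixed vectors\<close>

lemma pigeonhole_fibre:
  assumes "finite X" "finite B" "f ` X \<subseteq> B" "card B * m < card X"
  shows "\<exists>b\<in>B. m < card {x \<in> X. f x = b}"
proof (rule ccontr)
  assume "\<not> ?thesis"
  then have le: "card {x \<in> X. f x = b} \<le> m" if "b \<in> B" for b using that by force
  have "card X = card (\<Union>b\<in>B. {x \<in> X. f x = b})"
    using assms(3) by (intro arg_cong[of _ _ card]) auto
  also have "\<dots> \<le> (\<Sum>b\<in>B. card {x \<in> X. f x = b})"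
    by (rule card_UN_le[OF assms(2)])
  also have "\<dots> \<le> of_nat (card B) * m" by (rule sum_bounded_above[OF le])
  finally show False using assms(4) by simp
qed

text \<open>\<open>M\<close> is chosen before the seminorm, so it serves state norms that are
  constructed only later. Points are counted by index, so equal vectors at distinct indices qualify.
  The induction on \<open>n\<close> clears one coordinate by subtracting multiples of a pivot
  vector, which at most doubles the radius, and sorts the multiples into finitely many
  cells.\<close>

lemma seminorm_balls_uniformly_totally_bounded_aux:
  assumes "0 < \<epsilon>" "0 < R" "n \<le> d"
  shows "\<exists>M. \<forall>q (X :: 'i set) x. seminorm_on d q \<longrightarrow> finite X \<longrightarrow> M < card X \<longrightarrow>
    (\<forall>k\<in>X. x k \<in> carrier_vec d \<and> (\<forall>i. n \<le> i \<and> i < d \<longrightarrow> x k $ i = 0) \<and> q (x k) \<le> R) \<longrightarrow>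
    (\<exists>j\<in>X. \<exists>k\<in>X. j \<noteq> k \<and> q (x j - x k) \<le> \<epsilon>)"
  using assms
proof (induction n arbitrary: \<epsilon> R)
  case 0
  show ?case
  proof (intro exI[of _ 1] allI impI)
    fix q and X :: "'i set" and x
    assume q: "seminorm_on d q" and "finite X" and "1 < card X" and
      x: "\<forall>k\<in>X. x k \<in> carrier_vec d \<and> (\<forall>i. 0 \<le> i \<and> i < d \<longrightarrow> x k $ i = 0) \<and> q (x k) \<le> R"
    then obtain j k where jk: "j \<in> X" "k \<in> X" "j \<noteq> k"
      by (metis card_le_Suc0_iff_eq One_nat_def not_le)
    then have "x j - x k = 0\<^sub>v d"
    proof (intro eq_vecI)
      fix i assume "i < dim_vec (0\<^sub>v d)"
      then have "x j $ i = 0" "x k $ i = 0" "i < d" "i < dim_vec (x k)" using x jk by auto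
      then show "(x j - x k) $ i = 0\<^sub>v d $ i" using x jk by simp
    qed (use x jk in auto)
    then show "\<exists>j\<in>X. \<exists>k\<in>X. j \<noteq> k \<and> q (x j - x k) \<le> \<epsilon>"
      using jk 0 seminorm_zero[OF q] by (metis less_imp_le)
  qed
next
  case (Suc n)
  have pos: "0 < \<epsilon> / 2" "0 < 2 * R" "n \<le> d" using Suc.prems by auto
  obtain M where
    M: "\<forall>q (X :: 'i set) x. seminorm_on d q \<longrightarrow> finite X \<longrightarrow> M < card X \<longrightarrow>
    (\<forall>k\<in>X. x k \<in> carrier_vec d \<and> (\<forall>i. n \<le> i \<and> i < d \<longrightarrow> x k $ i = 0) \<and> q (x k) \<le> 2 * R) \<longrightarrow>
    (\<exists>j\<in>X. \<exists>k\<in>X. j \<noteq> k \<and> q (x j - x k) \<le> \<epsilon> / 2)"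
    using Suc.IH[OF pos] by (elim exE)
  \<comment> \<open>The multiples are rounded with mesh 1 / D: equal floors leave a difference of at
    most \<epsilon> / (2 R), so restoring the pivot costs at most \<epsilon> / 2.\<close>
  define D where "D = 2 * R / \<epsilon>"
  have D: "D > 0" using Suc.prems by (simp add: D_def)
  define B where "B = {\<lfloor>- D\<rfloor>..\<lfloor>D\<rfloor>}"
  show ?case
  \<comment> \<open>One of the \<open>card B\<close> cells then holds more than \<open>M\<close>
    indices, enough for the induction hypothesis.\<close>
  proof (intro exI[of _ "card B * M"] allI impI)
    fix q and X :: "'i set" and x
    assume q: "seminorm_on d q" and X: "finite X" "card B * M < card X" and
      x: "\<forall>k\<in>X. x k \<in> carrier_vec d \<and> (\<forall>i. Suc n \<le> i \<and> i < d \<longrightarrow> x k $ i = 0) \<and> q (x k) \<le> R"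
    have xc: "x k \<in> carrier_vec d" if "k \<in> X" for k using x that by blast
    have "X \<noteq> {}" using X by auto
    define p where "p = arg_min_on (\<lambda>k. - \<bar>x k $ n\<bar>) X"
    have p: "p \<in> X" unfolding p_def using X(1) \<open>X \<noteq> {}\<close> by (rule arg_min_if_finite)
    have pmax: "\<bar>x k $ n\<bar> \<le> \<bar>x p $ n\<bar>" if "k \<in> X" for k
      using arg_min_if_finite(2)[OF X(1) \<open>X \<noteq> {}\<close>, of "\<lambda>k. - \<bar>x k $ n\<bar>"] that
      unfolding p_def[symmetric] by force
    \<comment> \<open>Pivoting on the largest last coordinate keeps the coefficients \<open>c k\<close> in \<open>[-1, 1]\<close> whatever the seminorm; this is what makes \<open>M\<close> independent of \<open>q\<close>. (If the pivot is 0, all \<open>c k\<close> are 0.)\<close>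
    define c where "c k = x k $ n / x p $ n" for k
    define y where "y k = x k - c k \<cdot>\<^sub>v x p" for k
    have c1: "\<bar>c k\<bar> \<le> 1" if "k \<in> X" for k
      using pmax[OF that] by (auto simp: c_def divide_simps)
    have yc: "y k \<in> carrier_vec d" if "k \<in> X" for k using xc[OF that] xc[OF p] by (simp add: y_def)
    have y0: "y k $ i = 0" if k: "k \<in> X" and i: "n \<le> i" "i < d" for k i
    proof (cases "i = n")
      case True
      have "x k $ n = c k * x p $ n" using pmax[OF k] by (cases "x p $ n = 0") (auto simp: c_def)
      then show ?thesis using True i xc[OF k] xc[OF p] by (simp add: y_def)
    next
      case False
      then have "x k $ i = 0" "x p $ i = 0" using x k p i by auto
      then show ?thesis using i xc[OF k] xc[OF p] by (simp add: y_def)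
    qed
    have qy: "q (y k) \<le> 2 * R" if k: "k \<in> X" for k
    proof -
      have "q (y k) \<le> q (x k) + \<bar>c k\<bar> * q (x p)"
        using seminorm_diff[OF q xc[OF k], of "c k \<cdot>\<^sub>v x p"] seminorm_smult[OF q xc[OF p], of "c k"] xc[OF p]
        by (simp add: y_def)
      also have "\<dots> \<le> R + 1 * R"
        using x k p c1[OF k] Suc.prems seminorm_nonneg[OF q xc[OF p]]
        by (intro add_mono mult_mono) auto
      finally show ?thesis by simp
    qed
    have "(\<lambda>k. \<lfloor>D * c k\<rfloor>) ` X \<subseteq> B"
    proof (clarsimp simp: B_def)
      fix k assume "k \<in> X"
      from c1[OF this] D have "- D \<le> D * c k" "D * c k \<le> D"
        using mult_left_mono[of "-1" "c k" D] mult_left_mono[of "c k" 1 D] by (auto simp: abs_le_iff)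
      then show "\<lfloor>- D\<rfloor> \<le> \<lfloor>D * c k\<rfloor> \<and> \<lfloor>D * c k\<rfloor> \<le> \<lfloor>D\<rfloor>"
        by (intro conjI floor_mono)
    qed
    from pigeonhole_fibre[OF X(1) _ this X(2)] obtain b
      where b: "M < card {k \<in> X. \<lfloor>D * c k\<rfloor> = b}" by (auto simp: B_def)
    obtain j k where jk: "j \<in> X" "k \<in> X" "\<lfloor>D * c j\<rfloor> = \<lfloor>D * c k\<rfloor>" "j \<noteq> k" "q (y j - y k) \<le> \<epsilon> / 2"
      using M[rule_format, OF q _ b, of y] X(1) yc y0 qy by auto
    have "\<bar>D * c j - D * c k\<bar> \<le> 1" using jk(3) by linarith
    then have "D * \<bar>c j - c k\<bar> \<le> 1" using D by (simp add: abs_mult flip: right_diff_distrib)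
    then have cR: "\<bar>c j - c k\<bar> * R \<le> \<epsilon> / 2" using Suc.prems by (simp add: D_def field_simps)
    have "x j - x k = (y j - y k) + (c j - c k) \<cdot>\<^sub>v x p"
      using xc[OF jk(1)] xc[OF jk(2)] xc[OF p]
      by (intro eq_vecI) (auto simp: y_def algebra_simps)
    then have "q (x j - x k) \<le> q (y j - y k) + \<bar>c j - c k\<bar> * q (x p)"
      using seminorm_add[OF q, of "y j - y k" "(c j - c k) \<cdot>\<^sub>v x p"] seminorm_smult[OF q xc[OF p]]
        yc[OF jk(1)] yc[OF jk(2)] xc[OF p] by simp
    also have "\<dots> \<le> \<epsilon> / 2 + \<bar>c j - c k\<bar> * R"
      using jk(5) x p by (intro add_mono mult_left_mono) auto
    finally have "q (x j - x k) \<le> \<epsilon>" using cR by simp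
    then show "\<exists>j\<in>X. \<exists>k\<in>X. j \<noteq> k \<and> q (x j - x k) \<le> \<epsilon>" using jk by blast
  qed
qed

lemma seminorm_balls_uniformly_totally_bounded:
  assumes "0 < \<epsilon>" "0 < R"
  shows "\<exists>M. \<forall>q (X :: 'i set) x. seminorm_on d q \<longrightarrow> finite X \<longrightarrow> M < card X \<longrightarrow>
    (\<forall>k\<in>X. x k \<in> carrier_vec d \<and> q (x k) \<le> R) \<longrightarrow>
    (\<exists>j\<in>X. \<exists>k\<in>X. j \<noteq> k \<and> q (x j - x k) \<le> \<epsilon>)"
proof -
  have vac: "(\<forall>i. d \<le> i \<and> i < d \<longrightarrow> v $ i = 0) \<longleftrightarrow> True" for v :: "real vec" by auto
  show ?thesis
    using seminorm_balls_uniformly_totally_bounded_aux[OF assms order_refl, of d]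
    unfolding vac by simp
qed

section \<open>Spectral radius of matrices with an almost fixed vector\<close>

lemma real_spectral_radius_ge:
  assumes "B \<in> carrier_mat d d" "eigenvalue (map_mat complex_of_real B) a"
  shows "norm a \<le> real_spectral_radius B"
proof -
  have C: "map_mat complex_of_real B \<in> carrier_mat d d" using assms by simp
  have "d > 0" using eigenvalue_imp_nonzero_dim[OF C assms(2)] .
  then show ?thesis
    unfolding real_spectral_radius_def
    using assms(2) by (intro spectral_radius_mem_max(2)[OF C]) (auto simp: spectrum_def)
qed

lemma real_spectral_radius_attained:
  assumes "B \<in> carrier_mat d d" "0 < d"
  obtains a where "eigenvalue (map_mat complex_of_real B) a" "norm a = real_spectral_radius B"
  using spectral_radius_mem_max(1)[of "map_mat complex_of_real B" d] assms
  by (auto simp: real_spectral_radius_def spectrum_def)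

lemma power_length_le_prod_list:
  fixes m :: real
  assumes "\<And>a. a \<in> set as \<Longrightarrow> m \<le> f a" "0 \<le> m"
  shows "m ^ length as \<le> (\<Prod>a\<leftarrow>as. f a)"
  using assms(1)
proof (induction as)
  case (Cons a as)
  have "m * m ^ length as \<le> f a * (\<Prod>a\<leftarrow>as. f a)"
    by (intro mult_mono) (use Cons assms(2) in \<open>auto intro: order_trans[OF assms(2)]\<close>)
  then show ?case by simp
qed simp

text \<open>By the Cayley-Hamilton theorem, \<open>p(1) y = -\<Sum>\<^sub>k p\<^sub>k (P\<^sup>k y - y)\<close> for the characteristic polynomial \<open>p\<close>, so that \<open>p(1)\<close>, the product of all \<open>1 - a\<close> for \<open>a\<close> an eigenvalue, is small.\<close>

lemma almost_fixed_imp_spectral_radius_gt: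
  assumes P: "P \<in> carrier_mat d d" and q: "seminorm_on d q" and y: "y \<in> carrier_vec d"
    and bound: "\<And>z. z \<in> carrier_vec d \<Longrightarrow> q (P *\<^sub>v z) \<le> 2 * q z"
    and close: "q (P *\<^sub>v y - y) \<le> \<epsilon>"
    and \<eta>: "0 \<le> \<eta>" "2 ^ (2 * d + 1) * \<epsilon> < \<eta> ^ d * q y"
  shows "1 - \<eta> < real_spectral_radius P"
proof (rule ccontr)
  assume neg: "\<not> ?thesis"
  define CP where "CP = map_mat complex_of_real P"
  have CP: "CP \<in> carrier_mat d d" using P by (simp add: CP_def)
  have ev: "norm a \<le> 1 - \<eta>" if "eigenvalue CP a" for a
    using real_spectral_radius_ge[OF P, of a] that neg by (simp add: CP_def)
  define p where "p = char_poly P"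
  from char_poly_factorized[OF CP] obtain as
    where as: "char_poly CP = (\<Prod>a\<leftarrow>as. [:- a, 1:])" "length as = d" by blast
  have as_ev: "norm a \<le> 1 - \<eta>" if "a \<in> set as" for a
  proof (rule ev)
    have "poly (char_poly CP) a = 0" unfolding as by (rule linear_poly_root[OF that])
    then show "eigenvalue CP a" by (simp add: eigenvalue_root_char_poly[OF CP])
  qed
  have cp: "char_poly CP = map_poly complex_of_real p"
    unfolding CP_def p_def by (rule of_real_hom.char_poly_hom[OF P])
  \<comment> \<open>By \<open>as_ev\<close> and \<eta> >= 0 all roots lie in the closed unit
    disk.\<close>
  have coeff_le: "\<bar>coeff p k\<bar> \<le> 2 ^ d" for k
  proof -
    have "norm (coeff (char_poly CP) k) \<le> 2 ^ length as"
      unfolding as(1) by (rule coeff_prod_linear_le) (use as_ev \<eta> in force)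
    then show ?thesis by (simp add: cp as(2))
  qed
  \<comment> \<open>Every eigenvalue has distance at least \<eta> from 1, and |p(1)| is the product
    of these distances.\<close>
  have "\<eta> ^ d \<le> (\<Prod>a\<leftarrow>as. norm (1 - a))"
    unfolding as(2)[symmetric]
  proof (rule power_length_le_prod_list)
    fix a assume "a \<in> set as"
    then show "\<eta> \<le> norm (1 - a)" using as_ev[of a] norm_triangle_ineq2[of 1 a] by simp
  qed (rule \<eta>)
  also have "\<dots> = norm (poly (char_poly CP) 1)"
    unfolding as(1) by (induction as) (simp_all add: norm_mult poly_mult del: mult_pCons_left)
  also have "poly (char_poly CP) 1 = complex_of_real (poly p 1)"
    unfolding cp using of_real_hom.poly_map_poly[of p 1] by simp
  finally have p1: "\<eta> ^ d \<le> \<bar>poly p 1\<bar>" by simp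
  define Y where "Y k = (((*\<^sub>v) P) ^^ k) y" for k
  have Yc: "Y k \<in> carrier_vec d" for k
    using y P by (induction k) (auto simp: Y_def)
  have YS: "Y (Suc k) = P *\<^sub>v Y k" for k by (simp add: Y_def)
  have \<epsilon>: "0 \<le> \<epsilon>" using close seminorm_nonneg[OF q, of "P *\<^sub>v y - y"] P y by force
  \<comment> \<open>Each application of \<open>P\<close> at most doubles the error made so far and
    adds a new \<epsilon>, which gives a geometric sum.\<close>
  have dist: "q (Y k - y) \<le> (2 ^ k - 1) * \<epsilon>" for k
  proof (induction k)
    case 0
    have "Y 0 - y = 0\<^sub>v d" using y by (intro eq_vecI) (auto simp: Y_def)
    then show ?case by (simp add: seminorm_zero[OF q])
  next
    case (Suc k)
    have "Y (Suc k) - y = P *\<^sub>v (Y k - y) + (P *\<^sub>v y - y)"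
    proof -
      have "P *\<^sub>v (Y k - y) = P *\<^sub>v Y k - P *\<^sub>v y"
        using P Yc y by (intro mult_minus_distrib_mat_vec)
      then show ?thesis using P Yc[of k] y by (intro eq_vecI) (auto simp: YS)
    qed
    then have "q (Y (Suc k) - y) \<le> q (P *\<^sub>v (Y k - y)) + q (P *\<^sub>v y - y)"
      using seminorm_add[OF q, of "P *\<^sub>v (Y k - y)" "P *\<^sub>v y - y"] P Yc[of k] y by simp
    also have "\<dots> \<le> 2 * ((2 ^ k - 1) * \<epsilon>) + \<epsilon>"
      using bound[of "Y k - y"] Suc close Yc[of k] y by simp
    also have "\<dots> = (2 ^ Suc k - 1) * \<epsilon>" by (simp add: algebra_simps)
    finally show ?case .
  qed
  have "poly p 1 \<cdot>\<^sub>v y = vec d (\<lambda>i. \<Sum>k\<le>d. - coeff p k * (Y k - y) $ i)"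
  proof (intro eq_vecI)
    fix i assume "i < dim_vec (vec d (\<lambda>i. \<Sum>k\<le>d. - coeff p k * (Y k - y) $ i))"
    then have i: "i < d" by simp
    have "degree p = d" using degree_monic_char_poly[OF P] by (simp add: p_def)
    then have "poly p 1 * y $ i = (\<Sum>k\<le>d. coeff p k * y $ i)"
      by (simp add: poly_altdef sum_distrib_right)
    also have "\<dots> = (\<Sum>k\<le>d. coeff p k * y $ i) - (\<Sum>k\<le>d. coeff p k * Y k $ i)"
      using char_poly_annihilates[OF P, of Y i] Yc YS i by (simp add: p_def)
    also have "\<dots> = (\<Sum>k\<le>d. - coeff p k * (Y k - y) $ i)"
      using i y by (simp add: sum_subtractf[symmetric] algebra_simps carrier_vecD)
    finally show "(poly p 1 \<cdot>\<^sub>v y) $ i = vec d (\<lambda>i. \<Sum>k\<le>d. - coeff p k * (Y k - y) $ i) $ i"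
      using i y by simp
  qed (use y in simp)
  then have "\<bar>poly p 1\<bar> * q y \<le> (\<Sum>k\<le>d. \<bar>- coeff p k\<bar> * q (Y k - y))"
    using seminorm_linear_combination[OF q, of "{..d}" "\<lambda>k. Y k - y" "\<lambda>k. - coeff p k"] Yc y
      seminorm_smult[OF q y, of "poly p 1"] by (simp add: minus_carrier_vec)
  \<comment> \<open>The coefficient bound 2 ^ d and the geometric sum, below 2 ^ (d + 1), multiply
    to the constant 2 ^ (2 * d + 1) of the hypothesis.\<close>
  also have "\<dots> \<le> (\<Sum>k\<le>d. 2 ^ d * (2 ^ k * \<epsilon>))"
  proof (intro sum_mono mult_mono)
    fix k show "q (Y k - y) \<le> 2 ^ k * \<epsilon>" using dist[of k] \<epsilon> by (simp add: algebra_simps)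
    show "0 \<le> q (Y k - y)" using seminorm_nonneg[OF q] Yc y by simp
  qed (use coeff_le in auto)
  also have "\<dots> = 2 ^ d * \<epsilon> * (\<Sum>k\<le>d. 2 ^ k)"
    by (simp add: sum_distrib_left mult_ac)
  also have "\<dots> \<le> 2 ^ d * \<epsilon> * 2 ^ (d + 1)"
  proof (intro mult_left_mono)
    have "(\<Sum>k\<le>d. (2::real) ^ k) = 2 ^ (d + 1) - 1" by (induction d) simp_all
    then show "(\<Sum>k\<le>d. (2::real) ^ k) \<le> 2 ^ (d + 1)" by simp
  qed (use \<epsilon> in simp)
  also have "\<dots> = 2 ^ (2 * d + 1) * \<epsilon>"
  proof -
    have "2 * d + 1 = d + (d + 1)" by simp
    then show ?thesis by (simp only: power_add mult_ac)
  qed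
  finally have "\<bar>poly p 1\<bar> * q y \<le> 2 ^ (2 * d + 1) * \<epsilon>" .
  moreover have "\<eta> ^ d * q y \<le> \<bar>poly p 1\<bar> * q y"
    using p1 seminorm_nonneg[OF q y] by (rule mult_right_mono)
  ultimately show False using \<eta>(2) by linarith
qed

section \<open>Growth rates and induced norms\<close>

text \<open>Split n into blocks of length \<open>m\<close> and a remainder below \<open>m\<close>:
  each block contributes at most c ^ m, and the finitely many remainders are absorbed by
  \<open>C\<close>.\<close>

lemma submultiplicative_exponential_bound:
  fixes a :: "nat \<Rightarrow> real"
  assumes nonneg: "\<And>n. 0 \<le> a n" and submult: "\<And>m n. a (m + n) \<le> a m * a n"
    and m: "1 \<le> m" "root m (a m) < c"
  shows "\<exists>C>0. \<forall>n. a n \<le> C * c ^ n"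
proof -
  have "0 \<le> root m (a m)" by (rule real_root_ge_zero[OF nonneg])
  then have c: "0 < c" using m by linarith
  have am: "a m \<le> c ^ m"
  proof -
    have "a m = root m (a m) ^ m" using m nonneg by simp
    also have "\<dots> \<le> c ^ m" using m nonneg by (intro power_mono) auto
    finally show ?thesis .
  qed
  define C where "C = 1 + (\<Sum>s<m. a s / c ^ s)"
  have sum_nn: "0 \<le> (\<Sum>s<m. a s / c ^ s)" using nonneg c by (intro sum_nonneg) simp
  have base: "a s \<le> C * c ^ s" if "s < m" for s
  proof -
    have "a s / c ^ s \<le> (\<Sum>s<m. a s / c ^ s)"
      using that nonneg c by (intro member_le_sum) auto
    then have "a s / c ^ s \<le> C" by (simp add: C_def)
    then show ?thesis using c by (simp add: field_simps)
  qed
  have residue: "a (k * m + s) \<le> C * c ^ (k * m + s)" if s: "s < m" for k s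
  proof (induction k)
    case 0
    then show ?case using base s by simp
  next
    case (Suc k)
    have "a (Suc k * m + s) \<le> a m * a (k * m + s)"
      using submult[of m "k * m + s"] by (simp add: add.assoc)
    also have "\<dots> \<le> c ^ m * (C * c ^ (k * m + s))"
      using am Suc nonneg c by (intro mult_mono) auto
    finally show ?case by (simp add: power_add mult_ac)
  qed
  have "a n \<le> C * c ^ n" for n
    using residue[of "n mod m" "n div m"] m by simp
  moreover have "0 < C" using sum_nn by (simp add: C_def)
  ultimately show ?thesis by blast
qed

text \<open>Fekete's lemma in multiplicative form: the limit is the infimum. That \<open>L\<close>
  is a lower bound at every index later gives L ^ n <= growth n.\<close>

lemma submultiplicative_root_converges:
  fixes a :: "nat \<Rightarrow> real"
  assumes nonneg: "\<And>n. 0 \<le> a n" and submult: "\<And>m n. a (m + n) \<le> a m * a n"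
  shows "\<exists>L\<ge>0. (\<lambda>n. root n (a n)) \<longlonglongrightarrow> L \<and> (\<forall>n\<ge>1. L \<le> root n (a n))"
proof -
  define L where "L = (INF n\<in>{1..}. root n (a n))"
  have bdd: "bdd_below ((\<lambda>n. root n (a n)) ` {1..})"
    using nonneg by (intro bdd_belowI[of _ 0]) auto
  have le: "L \<le> root n (a n)" if "1 \<le> n" for n
    unfolding L_def using that by (intro cINF_lower[OF bdd]) simp
  have L: "0 \<le> L"
    unfolding L_def using nonneg by (intro cINF_greatest) auto
  have "(\<lambda>n. root n (a n)) \<longlonglongrightarrow> L"
  proof (rule order_tendstoI)
    fix c assume "c < L"
    then have "c < root n (a n)" if "n \<ge> 1" for n using le[OF that] by linarith
    then show "\<forall>\<^sub>F n in sequentially. c < root n (a n)"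
      by (rule eventually_sequentiallyI)
  next
    fix c assume "L < c"
    then obtain b where b: "L < b" "b < c" using dense by blast
    from b(1) obtain m where m: "1 \<le> m" "root m (a m) < b"
      using cINF_less_iff[OF _ bdd, of b] by (auto simp: L_def)
    from submultiplicative_exponential_bound[OF nonneg submult m] obtain C
      where C: "0 < C" "\<And>n. a n \<le> C * b ^ n" by blast
    have "(\<lambda>n. root n C * b) \<longlonglongrightarrow> 1 * b"
      using C by (intro tendsto_mult LIMSEQ_root_const tendsto_const)
    then have ev: "\<forall>\<^sub>F n in sequentially. root n C * b < c"
      using b by (auto dest: order_tendstoD)
    have le': "root n (a n) \<le> root n C * b" if "n \<ge> 1" for n
    proof -
      have "root n (a n) \<le> root n (C * b ^ n)" using C that by (intro real_root_le_mono) auto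
      also have "\<dots> = root n C * b" using that L b by (simp add: real_root_mult real_root_power_cancel)
      finally show ?thesis .
    qed
    show "\<forall>\<^sub>F n in sequentially. root n (a n) < c"
      using eventually_conj[OF ev eventually_ge_at_top[of 1]]
      by (rule eventually_mono) (use le' in \<open>force intro: order.strict_trans1\<close>)
  qed
  with le L show ?thesis by blast
qed

section \<open>The induced operator norm\<close>

context
  fixes d :: nat and N :: "real vec \<Rightarrow> real"
  assumes d: "1 \<le> d" and N: "vec_norm_on d N"
begin

lemma norm_pos:
  assumes "v \<in> carrier_vec d" "v \<noteq> 0\<^sub>v d"
  shows "0 < N v"
proof -
  have "0 \<le> N v" "N v \<noteq> 0" using N assms by (simp_all add: vec_norm_on_def)
  then show ?thesis by simp
qed

lemma unit_sphere_nonempty: "{v \<in> carrier_vec d. N v = 1} \<noteq> {}"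
proof -
  define e where "e = (unit_vec d 0 :: real vec)"
  have e: "e \<in> carrier_vec d" by (simp add: e_def)
  have "e $ 0 \<noteq> 0\<^sub>v d $ 0" using d by (simp add: e_def)
  then have "0 < N e" using norm_pos[OF e] by auto
  then have "N ((1 / N e) \<cdot>\<^sub>v e) = 1"
    using e by (simp add: seminorm_smult[OF vec_norm_on_imp_seminorm_on[OF N]])
  moreover have "(1 / N e) \<cdot>\<^sub>v e \<in> carrier_vec d" using e by simp
  ultimately show ?thesis by blast
qed

lemma bdd_above_induced_norm:
  assumes "B \<in> carrier_mat d d"
  shows "bdd_above ((\<lambda>v. N (B *\<^sub>v v)) ` {v \<in> carrier_vec d. N v = 1})"
proof -
  obtain C where "\<And>v. v \<in> carrier_vec d \<Longrightarrow> N (B *\<^sub>v v) \<le> C * N v"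
    using seminorm_le_norm[OF N seminorm_on_mult_mat_vec[OF vec_norm_on_imp_seminorm_on[OF N] assms]]
    by blast
  from this show ?thesis by (intro bdd_aboveI2[of _ _ C]) fastforce
qed

lemma induced_norm_upper:
  assumes B: "B \<in> carrier_mat d d" and v: "v \<in> carrier_vec d"
  shows "N (B *\<^sub>v v) \<le> induced_norm d N B * N v"
proof (cases "v = 0\<^sub>v d")
  case True
  then have "B *\<^sub>v v = 0\<^sub>v d" using B by (intro eq_vecI) auto
  then show ?thesis using True by (simp add: seminorm_zero[OF vec_norm_on_imp_seminorm_on[OF N]])
next
  case False
  note q = vec_norm_on_imp_seminorm_on[OF N]
  define u where "u = (1 / N v) \<cdot>\<^sub>v v"
  have u: "u \<in> carrier_vec d" "N u = 1"
    using v norm_pos[OF v False] by (simp_all add: u_def seminorm_smult[OF q])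
  have "N (B *\<^sub>v u) \<le> induced_norm d N B"
    unfolding induced_norm_def using u by (intro cSUP_upper[OF _ bdd_above_induced_norm[OF B]]) simp
  moreover have "B *\<^sub>v u = (1 / N v) \<cdot>\<^sub>v (B *\<^sub>v v)"
    unfolding u_def using B v by (intro mult_mat_vec)
  moreover have "N ((1 / N v) \<cdot>\<^sub>v (B *\<^sub>v v)) = N (B *\<^sub>v v) / N v"
    using seminorm_smult[OF q, of "B *\<^sub>v v" "1 / N v"] B v norm_pos[OF v False] by simp
  ultimately show ?thesis
    using norm_pos[OF v False] by (simp add: pos_divide_le_eq)
qed

lemma induced_norm_least:
  assumes "\<And>v. v \<in> carrier_vec d \<Longrightarrow> N (B *\<^sub>v v) \<le> c * N v"
  shows "induced_norm d N B \<le> c"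
  unfolding induced_norm_def
proof (rule cSUP_least[OF unit_sphere_nonempty])
  fix v assume "v \<in> {v \<in> carrier_vec d. N v = 1}"
  then show "N (B *\<^sub>v v) \<le> c" using assms[of v] by simp
qed

lemma induced_norm_nonneg:
  assumes B: "B \<in> carrier_mat d d"
  shows "0 \<le> induced_norm d N B"
proof -
  obtain v where v: "v \<in> carrier_vec d" "N v = 1" using unit_sphere_nonempty by auto
  have "0 \<le> N (B *\<^sub>v v)"
    using seminorm_nonneg[OF vec_norm_on_imp_seminorm_on[OF N]] B v by simp
  with induced_norm_upper[OF B v(1)] v(2) show ?thesis by simp
qed

lemma induced_norm_mult:
  assumes B: "B \<in> carrier_mat d d" and C: "C \<in> carrier_mat d d"
  shows "induced_norm d N (B * C) \<le> induced_norm d N B * induced_norm d N C"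
proof (rule induced_norm_least)
  fix v :: "real vec" assume v: "v \<in> carrier_vec d"
  have "N (B * C *\<^sub>v v) = N (B *\<^sub>v (C *\<^sub>v v))" using B C v by simp
  also have "\<dots> \<le> induced_norm d N B * N (C *\<^sub>v v)" using C v by (intro induced_norm_upper[OF B]) simp
  also have "\<dots> \<le> induced_norm d N B * (induced_norm d N C * N v)"
    using induced_norm_upper[OF C v] induced_norm_nonneg[OF B] by (rule mult_left_mono)
  finally show "N (B * C *\<^sub>v v) \<le> induced_norm d N B * induced_norm d N C * N v" by simp
qed

text \<open>A complex eigenvector is handled through its real and imaginary parts, on which
  \<open>B\<close> acts separately. The sum \<open>S\<close> of their norms is homogeneous over the
  complex numbers only up to a factor 2, which disappears once roots of high powers are
  taken.\<close>

lemma eigenvalue_le_induced_norm: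
  assumes B: "B \<in> carrier_mat d d" and ev: "eigenvalue (map_mat complex_of_real B) z"
  shows "norm z \<le> 2 * induced_norm d N B"
proof (cases "z = 0")
  case True
  then show ?thesis using induced_norm_nonneg[OF B] by simp
next
  case False
  note q = vec_norm_on_imp_seminorm_on[OF N]
  obtain v where v: "v \<in> carrier_vec d" "v \<noteq> 0\<^sub>v d"
    and Bv: "map_mat complex_of_real B *\<^sub>v v = z \<cdot>\<^sub>v v"
    using ev B by (auto simp: eigenvalue_def eigenvector_def)
  define S where "S u = N (map_vec Re u) + N (map_vec Im u)" for u
  have S_smult: "S (c \<cdot>\<^sub>v u) \<le> 2 * norm c * S u" if u: "u \<in> carrier_vec d" for c u
  proof -
    let ?r = "map_vec Re u" and ?i = "map_vec Im u"
    have ri: "?r \<in> carrier_vec d" "?i \<in> carrier_vec d" using u by auto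
    have c: "\<bar>Re c\<bar> \<le> norm c" "\<bar>Im c\<bar> \<le> norm c"
      by (rule abs_Re_le_cmod abs_Im_le_cmod)+
    have le: "\<bar>x\<bar> * N w \<le> norm c * N w" if "\<bar>x\<bar> \<le> norm c" "w \<in> carrier_vec d" for x w
      using that seminorm_nonneg[OF q] by (intro mult_right_mono) auto
    have "map_vec Re (c \<cdot>\<^sub>v u) = Re c \<cdot>\<^sub>v ?r - Im c \<cdot>\<^sub>v ?i"
      using u by (intro eq_vecI) auto
    then have "N (map_vec Re (c \<cdot>\<^sub>v u)) \<le> norm c * N ?r + norm c * N ?i"
      using seminorm_diff[OF q, of "Re c \<cdot>\<^sub>v ?r" "Im c \<cdot>\<^sub>v ?i"] ri
        le[OF c(1) ri(1)] le[OF c(2) ri(2)] by (simp add: seminorm_smult[OF q])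
    moreover have "map_vec Im (c \<cdot>\<^sub>v u) = Re c \<cdot>\<^sub>v ?i + Im c \<cdot>\<^sub>v ?r"
      using u by (intro eq_vecI) auto
    then have "N (map_vec Im (c \<cdot>\<^sub>v u)) \<le> norm c * N ?i + norm c * N ?r"
      using seminorm_add[OF q, of "Re c \<cdot>\<^sub>v ?i" "Im c \<cdot>\<^sub>v ?r"] ri
        le[OF c(1) ri(2)] le[OF c(2) ri(1)] by (simp add: seminorm_smult[OF q])
    ultimately show ?thesis by (simp add: S_def algebra_simps)
  qed
  have "S (map_mat complex_of_real B *\<^sub>v v) \<le> induced_norm d N B * S v"
  proof -
    have "map_vec Re (map_mat complex_of_real B *\<^sub>v v) = B *\<^sub>v map_vec Re v"
      "map_vec Im (map_mat complex_of_real B *\<^sub>v v) = B *\<^sub>v map_vec Im v"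
      using B v by (auto intro!: eq_vecI simp: scalar_prod_def)
    then show ?thesis
      using induced_norm_upper[OF B, of "map_vec Re v"] induced_norm_upper[OF B, of "map_vec Im v"] v(1)
      by (simp add: S_def algebra_simps)
  qed
  then have "S (z \<cdot>\<^sub>v v) \<le> induced_norm d N B * S v" by (simp add: Bv)
  \<comment> \<open>\<open>S_smult\<close> gives upper bounds only; used with the scalar 1 / z it
    bounds \<open>S (z \<cdot>\<^sub>v v)\<close> from below.\<close>
  moreover have "(1 / z) \<cdot>\<^sub>v (z \<cdot>\<^sub>v v) = v"
    using False by (intro eq_vecI) auto
  with S_smult[of "z \<cdot>\<^sub>v v" "1 / z"] v(1) have "norm z * S v \<le> 2 * S (z \<cdot>\<^sub>v v)"
    using False by (simp add: norm_divide field_simps)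
  ultimately have le: "norm z * S v \<le> (2 * induced_norm d N B) * S v" by simp
  have "map_vec Re v \<noteq> 0\<^sub>v d \<or> map_vec Im v \<noteq> 0\<^sub>v d"
  proof (rule ccontr)
    assume "\<not> ?thesis"
    then have e: "map_vec Re v = 0\<^sub>v d" "map_vec Im v = 0\<^sub>v d" by auto
    have "v $ i = 0" if "i < d" for i
      using arg_cong[OF e(1), of "\<lambda>u. u $ i"] arg_cong[OF e(2), of "\<lambda>u. u $ i"] that v(1)
      by (simp add: complex_eq_iff)
    then show False using v by (auto intro: eq_vecI)
  qed
  then have "0 < S v"
    using norm_pos[of "map_vec Re v"] norm_pos[of "map_vec Im v"] v(1)
      seminorm_nonneg[OF q, of "map_vec Re v"] seminorm_nonneg[OF q, of "map_vec Im v"]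
    by (force simp: S_def)
  with le show ?thesis by simp
qed

end

lemma eigenvalue_pow:
  assumes "B \<in> carrier_mat d d" "eigenvalue (map_mat complex_of_real B) z"
  shows "eigenvalue (map_mat complex_of_real (B ^\<^sub>m k)) (z ^ k)"
proof -
  have C: "map_mat complex_of_real B \<in> carrier_mat d d" using assms by simp
  obtain v where v: "eigenvector (map_mat complex_of_real B) v z"
    using assms(2) by (auto simp: eigenvalue_def)
  have "map_mat complex_of_real (B ^\<^sub>m k) = map_mat complex_of_real B ^\<^sub>m k"
    by (rule of_real_hom.mat_hom_pow[OF assms(1)])
  then show ?thesis
    using eigenvector_pow[OF C v, of k] v assms(1)
    by (auto simp: eigenvalue_def eigenvector_def)
qed

section \<open>Admissible sequences and periodic words\<close>

lemma real_spectral_radius_smult_le: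
  assumes B: "B \<in> carrier_mat d d" and d: "0 < d" and s: "0 < s"
  shows "real_spectral_radius (s \<cdot>\<^sub>m B) \<le> s * real_spectral_radius B"
proof -
  let ?B = "map_mat complex_of_real B"
  obtain a where a: "eigenvalue (map_mat complex_of_real (s \<cdot>\<^sub>m B)) a"
    "norm a = real_spectral_radius (s \<cdot>\<^sub>m B)"
    using real_spectral_radius_attained[of "s \<cdot>\<^sub>m B" d] B d by auto
  then obtain v where v: "v \<in> carrier_vec d" "v \<noteq> 0\<^sub>v d"
    "map_mat complex_of_real (s \<cdot>\<^sub>m B) *\<^sub>v v = a \<cdot>\<^sub>v v"
    using B by (auto simp: eigenvalue_def eigenvector_def)
  have "map_mat complex_of_real (s \<cdot>\<^sub>m B) *\<^sub>v v = complex_of_real s \<cdot>\<^sub>v (?B *\<^sub>v v)"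
    using B v(1) by (intro eq_vecI) (auto simp: scalar_prod_def sum_distrib_left mult.assoc)
  then have e: "complex_of_real s \<cdot>\<^sub>v (?B *\<^sub>v v) = a \<cdot>\<^sub>v v" using v by simp
  have "?B *\<^sub>v v = (a / complex_of_real s) \<cdot>\<^sub>v v"
  proof (intro eq_vecI)
    fix i assume i: "i < dim_vec ((a / complex_of_real s) \<cdot>\<^sub>v v)"
    then have "complex_of_real s * (?B *\<^sub>v v) $ i = a * v $ i"
      using arg_cong[OF e, of "\<lambda>u. u $ i"] B v by simp
    then show "(?B *\<^sub>v v) $ i = ((a / complex_of_real s) \<cdot>\<^sub>v v) $ i"
      using i s by (simp add: nonzero_eq_divide_eq mult.commute)
  qed (use B v in auto)
  then have "eigenvalue ?B (a / complex_of_real s)"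
    using B v by (auto simp: eigenvalue_def eigenvector_def)
  from real_spectral_radius_ge[OF B this] a s show ?thesis
    by (simp add: norm_divide pos_divide_le_eq mult.commute)
qed

lemma word_prod_cong:
  "(\<And>i. 1 \<le> i \<Longrightarrow> i \<le> n \<Longrightarrow> \<sigma> i = \<tau> i) \<Longrightarrow> word_prod d A \<sigma> n = word_prod d A \<tau> n"
  by (induction n) auto

locale markov_products =
  fixes d K :: nat and N :: "real vec \<Rightarrow> real" and A :: "nat \<Rightarrow> real mat"
    and T :: "nat \<Rightarrow> nat \<Rightarrow> nat"
  assumes d: "1 \<le> d"
    and N: "vec_norm_on d N"
    and A: "\<And>i. i \<in> {1..K} \<Longrightarrow> A i \<in> carrier_mat d d"
begin

abbreviation W :: "(nat \<Rightarrow> nat) \<Rightarrow> nat \<Rightarrow> real mat" where "W \<equiv> word_prod d A"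

text \<open>Unlike \<^const>\<open>markov_seqs\<close>, this leaves the value at 0 unconstrained, so that the set is closed under shifts.\<close>

definition adm :: "(nat \<Rightarrow> nat) set" where
  "adm = {\<sigma>. \<forall>n\<ge>1. \<sigma> n \<in> {1..K} \<and> T (\<sigma> n) (\<sigma> (n + 1)) = 1}"

lemma adm_letter: "\<sigma> \<in> adm \<Longrightarrow> 1 \<le> n \<Longrightarrow> \<sigma> n \<in> {1..K}"
  and adm_transition: "\<sigma> \<in> adm \<Longrightarrow> 1 \<le> n \<Longrightarrow> T (\<sigma> n) (\<sigma> (n + 1)) = 1"
  unfolding adm_def by blast+

lemma admI:
  "(\<And>n. 1 \<le> n \<Longrightarrow> \<sigma> n \<in> {1..K}) \<Longrightarrow> (\<And>n. 1 \<le> n \<Longrightarrow> T (\<sigma> n) (\<sigma> (n + 1)) = 1) \<Longrightarrow> \<sigma> \<in> adm"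
  unfolding adm_def by blast

lemma adm_shift:
  assumes "\<sigma> \<in> adm"
  shows "(\<lambda>i. \<sigma> (i + m)) \<in> adm"
proof (rule admI)
  fix n :: nat assume n: "1 \<le> n"
  show "\<sigma> (n + m) \<in> {1..K}" using adm_letter[OF assms, of "n + m"] n by simp
  show "T (\<sigma> (n + m)) (\<sigma> (n + 1 + m)) = 1" using adm_transition[OF assms, of "n + m"] n by simp
qed

text \<open>The switch to \<open>\<tau>\<close> after \<open>m\<close> letters is admissible because
  the first letter of \<open>\<tau>\<close> is the one that \<open>\<sigma>\<close> has at place m +
  1.\<close>

lemma adm_append:
  assumes \<sigma>: "\<sigma> \<in> adm" and \<tau>: "\<tau> \<in> adm" and eq: "\<tau> 1 = \<sigma> (m + 1)"
  shows "(\<lambda>i. if i \<le> m then \<sigma> i else \<tau> (i - m)) \<in> adm"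
proof (rule admI)
  fix n :: nat assume n: "1 \<le> n"
  show "(if n \<le> m then \<sigma> n else \<tau> (n - m)) \<in> {1..K}"
    using adm_letter[OF \<sigma>, of n] adm_letter[OF \<tau>, of "n - m"] n by auto
  consider "n < m" | "n = m" | "m < n" by linarith
  then show "T (if n \<le> m then \<sigma> n else \<tau> (n - m))
      (if n + 1 \<le> m then \<sigma> (n + 1) else \<tau> (n + 1 - m)) = 1"
  proof cases
    case 1
    then show ?thesis using adm_transition[OF \<sigma>, of n] n by simp
  next
    case 2
    then show ?thesis using adm_transition[OF \<sigma>, of n] n eq by simp
  next
    case 3
    then have "n + 1 - m = n - m + 1" by simp
    then show ?thesis using adm_transition[OF \<tau>, of "n - m"] 3 by simp
  qed
qed

lemma word_prod_carrier:
  "(\<And>i. 1 \<le> i \<Longrightarrow> i \<le> n \<Longrightarrow> \<sigma> i \<in> {1..K}) \<Longrightarrow> W \<sigma> n \<in> carrier_mat d d"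
proof (induction n)
  case (Suc n)
  then have "A (\<sigma> (Suc n)) \<in> carrier_mat d d" "W \<sigma> n \<in> carrier_mat d d" by (auto intro!: A)
  then show ?case by simp
qed simp

lemma W_carrier: "\<sigma> \<in> adm \<Longrightarrow> W \<sigma> n \<in> carrier_mat d d"
  by (intro word_prod_carrier adm_letter)

lemma W_add:
  assumes "\<sigma> \<in> adm"
  shows "W \<sigma> (m + n) = W (\<lambda>i. \<sigma> (i + m)) n * W \<sigma> m"
proof (induction n)
  case 0
  show ?case using W_carrier[OF assms, of m] by simp
next
  case (Suc n)
  have "A (\<sigma> (Suc (m + n))) \<in> carrier_mat d d"
    using adm_letter[OF assms, of "Suc (m + n)"] by (intro A) simp
  then show ?case
    using Suc W_carrier[OF assms, of m] W_carrier[OF adm_shift[OF assms], of m n]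
    by (simp add: add.commute[of n m])
qed

lemma W_add_vec:
  assumes "\<sigma> \<in> adm" "x \<in> carrier_vec d"
  shows "W \<sigma> (m + n) *\<^sub>v x = W (\<lambda>i. \<sigma> (i + m)) n *\<^sub>v (W \<sigma> m *\<^sub>v x)"
  unfolding W_add[OF assms(1)]
  by (rule assoc_mult_mat_vec[OF W_carrier[OF adm_shift[OF assms(1)]] W_carrier[OF assms(1)] assms(2)])

section \<open>Growth of the norms along admissible sequences\<close>

lemma image_markov_seqs: "(\<lambda>\<sigma>. f (W \<sigma> n)) ` markov_seqs K T = (\<lambda>\<sigma>. f (W \<sigma> n)) ` adm"
proof (intro equalityI image_subsetI)
  fix \<sigma> assume "\<sigma> \<in> markov_seqs K T"
  then have "\<sigma> \<in> adm" by (intro admI) (auto simp: markov_seqs_def PiE_iff)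
  then show "f (W \<sigma> n) \<in> (\<lambda>\<sigma>. f (W \<sigma> n)) ` adm" by blast
next
  fix \<sigma> assume \<sigma>: "\<sigma> \<in> adm"
  have "restrict \<sigma> {1..} \<in> {1..} \<rightarrow>\<^sub>E {1..K}"
    using adm_letter[OF \<sigma>] by (intro restrict_PiE_iff[THEN iffD2]) auto
  then have "restrict \<sigma> {1..} \<in> markov_seqs K T"
    using adm_transition[OF \<sigma>] by (simp add: markov_seqs_def)
  moreover have "W \<sigma> n = W (restrict \<sigma> {1..}) n" by (rule word_prod_cong) simp
  ultimately show "f (W \<sigma> n) \<in> (\<lambda>\<sigma>. f (W \<sigma> n)) ` markov_seqs K T" by (metis imageI)
qed

lemma finite_word_prods: "finite ((\<lambda>\<sigma>. W \<sigma> n) ` adm)"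
proof (rule finite_subset)
  show "(\<lambda>\<sigma>. W \<sigma> n) ` adm \<subseteq> (\<lambda>w. W w n) ` ({1..n} \<rightarrow>\<^sub>E {1..K})"
  proof (rule image_subsetI)
    fix \<sigma> assume \<sigma>: "\<sigma> \<in> adm"
    have "restrict \<sigma> {1..n} \<in> {1..n} \<rightarrow>\<^sub>E {1..K}"
      using adm_letter[OF \<sigma>] by (intro restrict_PiE_iff[THEN iffD2]) auto
    moreover have "W \<sigma> n = W (restrict \<sigma> {1..n}) n" by (rule word_prod_cong) simp
    ultimately show "W \<sigma> n \<in> (\<lambda>w. W w n) ` ({1..n} \<rightarrow>\<^sub>E {1..K})" by blast
  qed
qed (intro finite_imageI finite_PiE; simp)

text \<open>Taken without the root, so that submultiplicativity applies, and without a default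
  value: an empty \<open>adm\<close> is treated separately in
  \<open>markov_berger_wang\<close>.\<close>

definition growth :: "nat \<Rightarrow> real" where
  "growth n = Max ((\<lambda>\<sigma>. induced_norm d N (W \<sigma> n)) ` adm)"

lemma finite_norms: "finite ((\<lambda>\<sigma>. induced_norm d N (W \<sigma> n)) ` adm)"
  using finite_imageI[OF finite_word_prods, of "induced_norm d N"] by (simp add: image_image)

lemma growth_upper: "\<sigma> \<in> adm \<Longrightarrow> induced_norm d N (W \<sigma> n) \<le> growth n"
  unfolding growth_def using finite_norms by (intro Max_ge) auto

lemma growth_least:
  assumes "adm \<noteq> {}" "\<And>\<sigma>. \<sigma> \<in> adm \<Longrightarrow> induced_norm d N (W \<sigma> n) \<le> c"
  shows "growth n \<le> c"
  unfolding growth_def using finite_norms assms by (subst Max_le_iff) auto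

lemma growth_nonneg:
  assumes "adm \<noteq> {}"
  shows "0 \<le> growth n"
proof -
  obtain \<sigma> where "\<sigma> \<in> adm" using assms by blast
  then show ?thesis
    using growth_upper[of \<sigma> n] induced_norm_nonneg[OF d N W_carrier[of \<sigma> n]] by linarith
qed

lemma growth_submult:
  assumes "adm \<noteq> {}"
  shows "growth (m + n) \<le> growth m * growth n"
proof (rule growth_least[OF assms])
  fix \<sigma> assume \<sigma>: "\<sigma> \<in> adm"
  note shift = adm_shift[OF \<sigma>, of m]
  have "induced_norm d N (W \<sigma> (m + n))
      \<le> induced_norm d N (W (\<lambda>i. \<sigma> (i + m)) n) * induced_norm d N (W \<sigma> m)"
    unfolding W_add[OF \<sigma>] by (intro induced_norm_mult[OF d N] W_carrier \<sigma> shift)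
  also have "\<dots> \<le> growth n * growth m"
    using growth_upper[OF shift, of n] growth_upper[OF \<sigma>, of m] growth_nonneg[OF assms]
      induced_norm_nonneg[OF d N W_carrier[OF \<sigma>]]
    by (intro mult_mono) auto
  finally show "induced_norm d N (W \<sigma> (m + n)) \<le> growth m * growth n" by (simp add: mult.commute)
qed

lemma max_norm_eq_root_growth:
  assumes "adm \<noteq> {}" "1 \<le> n"
  shows "max_norm d N K A T n = root n (growth n)"
proof -
  have "mono (root n)" using assms(2) by (intro monoI real_root_le_mono) auto
  then have "root n (growth n) = Max (root n ` (\<lambda>\<sigma>. induced_norm d N (W \<sigma> n)) ` adm)"
    unfolding growth_def using finite_norms assms(1) by (intro mono_Max_commute) auto
  moreover have "(\<lambda>\<sigma>. root n (induced_norm d N (W \<sigma> n))) ` markov_seqs K T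
      = root n ` (\<lambda>\<sigma>. induced_norm d N (W \<sigma> n)) ` adm"
    using image_markov_seqs[of "\<lambda>B. root n (induced_norm d N B)" n] by (simp add: image_image)
  ultimately show ?thesis using assms(1) by (simp add: max_norm_def max_or_0_def)
qed

section \<open>Periodic words and the upper bound for their spectral radii\<close>

lemma periodic_wordI:
  assumes "\<sigma> \<in> adm" "1 \<le> n" "\<sigma> (n + 1) = \<sigma> 1"
  shows "restrict \<sigma> {1..n} \<in> periodic_words K T n"
proof -
  have "restrict \<sigma> {1..n} \<in> {1..n} \<rightarrow>\<^sub>E {1..K}"
    using adm_letter[OF assms(1)] by (intro restrict_PiE_iff[THEN iffD2]) auto
  moreover have "T (\<sigma> n) (\<sigma> 1) = 1"
    using adm_transition[OF assms(1,2)] unfolding assms(3) .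
  ultimately show ?thesis
    using adm_transition[OF assms(1)] assms(2)
    by (simp add: periodic_words_def)
qed

text \<open>The word is repeated forever; the transition from its last letter to its first makes
  this admissible. In particular, periodic words of positive length exist only if \<open>adm\<close>
  is nonempty.\<close>

lemma periodic_word_extension:
  assumes w: "w \<in> periodic_words K T n" and n: "1 \<le> n"
  obtains \<sigma> where "\<sigma> \<in> adm" "\<And>i. 1 \<le> i \<Longrightarrow> \<sigma> (i + n) = \<sigma> i" "W \<sigma> n = W w n"
proof
  \<comment> \<open>Letters are counted from 1, hence the shift by one before and after reduction
    modulo \<open>n\<close>.\<close>
  define \<sigma> where "\<sigma> i = w ((i - 1) mod n + 1)" for i
  have wK: "w k \<in> {1..K}" if "1 \<le> k" "k \<le> n" for k
    using w that by (auto simp: periodic_words_def PiE_iff)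
  have wT: "T (w k) (w (k + 1)) = 1" if "1 \<le> k" "k < n" for k
    using w that by (auto simp: periodic_words_def)
  have wn: "T (w n) (w 1) = 1" using w by (auto simp: periodic_words_def)
  show "\<sigma> \<in> adm"
  proof (rule admI)
    fix i :: nat assume i: "1 \<le> i"
    have lt: "(i - 1) mod n < n" using n by simp
    then show "\<sigma> i \<in> {1..K}" unfolding \<sigma>_def by (intro wK) auto
    have "(i + 1 - 1) mod n = Suc (i - 1) mod n" using i by simp
    also have "\<dots> = (if Suc ((i - 1) mod n) = n then 0 else Suc ((i - 1) mod n))"
      by (rule mod_Suc)
    finally have s: "\<sigma> (i + 1)
        = w ((if Suc ((i - 1) mod n) = n then 0 else Suc ((i - 1) mod n)) + 1)"
      by (simp add: \<sigma>_def)
    show "T (\<sigma> i) (\<sigma> (i + 1)) = 1"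
    proof (cases "Suc ((i - 1) mod n) = n")
      case True
      then show ?thesis using wn unfolding s by (simp add: \<sigma>_def)
    next
      case False
      then show ?thesis using wT[of "(i - 1) mod n + 1"] lt unfolding s by (simp add: \<sigma>_def)
    qed
  qed
  show "\<sigma> (i + n) = \<sigma> i" if "1 \<le> i" for i
  proof -
    have "i + n - 1 = (i - 1) + n" using that by simp
    then show ?thesis by (simp add: \<sigma>_def)
  qed
  show "W \<sigma> n = W w n" by (rule word_prod_cong) (simp add: \<sigma>_def)
qed

lemma W_periodic_power:
  assumes \<sigma>: "\<sigma> \<in> adm" and per: "\<And>i. 1 \<le> i \<Longrightarrow> \<sigma> (i + n) = \<sigma> i"
  shows "W \<sigma> (n * k) = W \<sigma> n ^\<^sub>m k"
proof (induction k)
  case 0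
  show ?case using W_carrier[OF \<sigma>, of n] by simp
next
  case (Suc k)
  have "W \<sigma> (n * Suc k) = W (\<lambda>i. \<sigma> (i + n)) (n * k) * W \<sigma> n"
    using W_add[OF \<sigma>, of n "n * k"] by simp
  also have "W (\<lambda>i. \<sigma> (i + n)) (n * k) = W \<sigma> (n * k)"
    by (rule word_prod_cong) (rule per)
  finally show ?case using Suc by simp
qed

lemma finite_periodic_words: "finite (periodic_words K T n)"
  by (rule finite_subset[of _ "{1..n} \<rightarrow>\<^sub>E {1..K}"]) (auto simp: periodic_words_def intro!: finite_PiE)

lemma max_spectral_upper:
  assumes "w \<in> periodic_words K T n"
  shows "root n (real_spectral_radius (W w n)) \<le> max_spectral d K A T n"
proof -
  have "periodic_words K T n \<noteq> {}" using assms by blast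
  then show ?thesis
    using assms finite_periodic_words by (simp add: max_spectral_def max_or_0_def)
qed

lemma max_spectral_least:
  assumes "\<And>w. w \<in> periodic_words K T n \<Longrightarrow> root n (real_spectral_radius (W w n)) \<le> c" "0 \<le> c"
  shows "max_spectral d K A T n \<le> c"
  using assms finite_periodic_words by (auto simp: max_spectral_def max_or_0_def)

lemma real_spectral_radius_nonneg:
  assumes "B \<in> carrier_mat d d"
  shows "0 \<le> real_spectral_radius B"
proof -
  have "0 < d" using d by simp
  from real_spectral_radius_attained[OF assms this] obtain a :: complex
    where "norm a = real_spectral_radius B" by blast
  then show ?thesis using norm_ge_zero[of a] by simp
qed

lemma periodic_word_carrier:
  assumes "w \<in> periodic_words K T n"
  shows "W w n \<in> carrier_mat d d"
  using assms by (intro word_prod_carrier) (auto simp: periodic_words_def PiE_iff)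

lemma max_spectral_nonneg: "0 \<le> max_spectral d K A T n"
proof (cases "periodic_words K T n = {}")
  case True
  then show ?thesis by (simp add: max_spectral_def max_or_0_def)
next
  case False
  then obtain w where w: "w \<in> periodic_words K T n" by blast
  have "0 \<le> root n (real_spectral_radius (W w n))"
    by (intro real_root_ge_zero real_spectral_radius_nonneg periodic_word_carrier w)
  then show ?thesis using max_spectral_upper[OF w] by linarith
qed

text \<open>Repeating \<open>w\<close> k times gives a product with an eigenvalue of modulus \<rho>
  ^ k, which is at most twice the growth at n k. Under the root of order n k the factor 2 tends to
  1.\<close>

lemma max_spectral_le_limit:
  assumes lim: "(\<lambda>n. root n (growth n)) \<longlonglongrightarrow> L" and L: "0 \<le> L" and n: "1 \<le> n"
  shows "max_spectral d K A T n \<le> L"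
proof (rule max_spectral_least[OF _ L])
  fix w assume w: "w \<in> periodic_words K T n"
  obtain \<sigma> where \<sigma>: "\<sigma> \<in> adm" "\<And>i. 1 \<le> i \<Longrightarrow> \<sigma> (i + n) = \<sigma> i" "W \<sigma> n = W w n"
    using periodic_word_extension[OF w n] by metis
  have B: "W w n \<in> carrier_mat d d" by (rule periodic_word_carrier[OF w])
  obtain a where a: "eigenvalue (map_mat complex_of_real (W w n)) a"
    "norm a = real_spectral_radius (W w n)"
    using real_spectral_radius_attained[OF B] d by auto
  let ?\<rho> = "real_spectral_radius (W w n)"
  have le: "root n ?\<rho> \<le> root (n * Suc k) 2 * root (n * Suc k) (growth (n * Suc k))" for k
  proof -
    have "?\<rho> ^ Suc k = norm (a ^ Suc k)" by (simp only: a(2) norm_power)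
    also have "\<dots> \<le> 2 * induced_norm d N (W \<sigma> (n * Suc k))"
      using eigenvalue_le_induced_norm[OF d N _ eigenvalue_pow[OF B a(1), of "Suc k"]] B
      by (simp only: W_periodic_power[OF \<sigma>(1,2)] \<sigma>(3) pow_carrier_mat)
    also have "\<dots> \<le> 2 * growth (n * Suc k)" using growth_upper[OF \<sigma>(1)] by simp
    finally have "root (n * Suc k) (?\<rho> ^ Suc k) \<le> root (n * Suc k) (2 * growth (n * Suc k))"
      using n by (intro real_root_le_mono) auto
    moreover have "root (n * Suc k) (?\<rho> ^ Suc k) = root n ?\<rho>"
      using real_spectral_radius_nonneg[OF B]
      by (simp only: real_root_mult_exp real_root_power_cancel zero_less_Suc)
    ultimately show ?thesis by (simp only: real_root_mult)
  qed
  have r: "filterlim (\<lambda>k. n * Suc k) sequentially sequentially"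
    by (rule filterlim_subseq) (use n in \<open>auto simp: strict_mono_def\<close>)
  have "(\<lambda>k. root (n * Suc k) 2 * root (n * Suc k) (growth (n * Suc k))) \<longlonglongrightarrow> 1 * L"
    using filterlim_compose[OF LIMSEQ_root_const[of 2] r] filterlim_compose[OF lim r]
    by (intro tendsto_mult) auto
  then show "root n ?\<rho> \<le> L" using le by (intro LIMSEQ_le_const) auto
qed

end

section \<open>State-dependent norms along paths\<close>

context markov_products
begin

text \<open>The weighted supremum norm attached to the state \<open>s\<close>: reading an admissible letter maps the norm of its state to the norm of the next state with operator norm at most \<open>g\<close>.\<close>

definition path_norm :: "real \<Rightarrow> nat \<Rightarrow> real vec \<Rightarrow> real" where
  "path_norm g s x =
     (SUP (\<sigma>, n) \<in> {\<sigma> \<in> adm. \<sigma> 1 = s} \<times> UNIV. N (W \<sigma> n *\<^sub>v x) / g ^ n)"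

context
  fixes g C :: real
  assumes g: "0 < g" and C: "\<And>n. growth n \<le> C * g ^ n"
begin

text \<open>One bound for all terms of the supremum: it makes \<open>path_norm\<close> finite and
  comparable with \<open>N\<close>.\<close>

lemma path_norm_term_le:
  assumes "\<sigma> \<in> adm" "x \<in> carrier_vec d"
  shows "N (W \<sigma> n *\<^sub>v x) / g ^ n \<le> C * N x"
proof -
  have Nx: "0 \<le> N x" using seminorm_nonneg[OF vec_norm_on_imp_seminorm_on[OF N] assms(2)] .
  have "N (W \<sigma> n *\<^sub>v x) \<le> induced_norm d N (W \<sigma> n) * N x"
    by (rule induced_norm_upper[OF d N W_carrier[OF assms(1)] assms(2)])
  also have "\<dots> \<le> (C * g ^ n) * N x"
    using growth_upper[OF assms(1), of n] C[of n] Nx by (intro mult_right_mono) auto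
  finally show ?thesis using g by (simp add: pos_divide_le_eq mult_ac)
qed

lemma path_norm_upper:
  assumes "\<sigma> \<in> adm" "x \<in> carrier_vec d"
  shows "N (W \<sigma> n *\<^sub>v x) \<le> g ^ n * path_norm g (\<sigma> 1) x"
proof -
  have "(case (\<sigma>, n) of (\<sigma>, n) \<Rightarrow> N (W \<sigma> n *\<^sub>v x) / g ^ n) \<le> path_norm g (\<sigma> 1) x"
    unfolding path_norm_def
    by (intro cSUP_upper bdd_aboveI[of _ "C * N x"]) (use assms path_norm_term_le in auto)
  then show ?thesis using g by (simp add: pos_divide_le_eq mult.commute)
qed

text \<open>Writing the state as \<open>\<sigma> 1\<close> with \<open>\<sigma>\<close> admissible
  guarantees that the supremum is over a nonempty set.\<close>

lemma path_norm_least: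
  assumes "\<sigma> \<in> adm"
    and "\<And>\<tau> n. \<tau> \<in> adm \<Longrightarrow> \<tau> 1 = \<sigma> 1 \<Longrightarrow> N (W \<tau> n *\<^sub>v x) \<le> g ^ n * c"
  shows "path_norm g (\<sigma> 1) x \<le> c"
  unfolding path_norm_def
proof (rule cSUP_least)
  show "{\<tau> \<in> adm. \<tau> 1 = \<sigma> 1} \<times> UNIV \<noteq> ({} :: ((nat \<Rightarrow> nat) \<times> nat) set)" using assms(1) by blast
  fix p assume "p \<in> {\<tau> \<in> adm. \<tau> 1 = \<sigma> 1} \<times> (UNIV :: nat set)"
  then show "(case p of (\<tau>, n) \<Rightarrow> N (W \<tau> n *\<^sub>v x) / g ^ n) \<le> c"
    using assms(2)[of "fst p" "snd p"] g by (auto simp: pos_divide_le_eq mult.commute)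
qed

lemma norm_le_path_norm:
  assumes "\<sigma> \<in> adm" "x \<in> carrier_vec d"
  shows "N x \<le> path_norm g (\<sigma> 1) x"
  using path_norm_upper[OF assms, of 0] assms(2) by simp

lemma path_norm_le:
  assumes "\<sigma> \<in> adm" "x \<in> carrier_vec d"
  shows "path_norm g (\<sigma> 1) x \<le> C * N x"
proof (rule path_norm_least[OF assms(1)])
  fix \<tau> n assume "\<tau> \<in> adm"
  from path_norm_term_le[OF this assms(2), of n]
  show "N (W \<tau> n *\<^sub>v x) \<le> g ^ n * (C * N x)" using g by (simp add: pos_divide_le_eq mult.commute)
qed

lemma seminorm_on_path_norm:
  assumes \<sigma>: "\<sigma> \<in> adm"
  shows "seminorm_on d (path_norm g (\<sigma> 1))"
proof -
  note q = vec_norm_on_imp_seminorm_on[OF N]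
  let ?Q = "path_norm g (\<sigma> 1)"
  have smult_le: "?Q (c \<cdot>\<^sub>v x) \<le> \<bar>c\<bar> * ?Q x" if x: "x \<in> carrier_vec d" for c x
  proof (rule path_norm_least[OF \<sigma>])
    fix \<tau> n assume \<tau>: "\<tau> \<in> adm" "\<tau> 1 = \<sigma> 1"
    have "N (W \<tau> n *\<^sub>v (c \<cdot>\<^sub>v x)) = \<bar>c\<bar> * N (W \<tau> n *\<^sub>v x)"
      using seminorm_smult[OF seminorm_on_mult_mat_vec[OF q W_carrier[OF \<tau>(1)]] x] .
    also have "\<dots> \<le> \<bar>c\<bar> * (g ^ n * ?Q x)"
      using path_norm_upper[OF \<tau>(1) x, of n] \<tau>(2) by (intro mult_left_mono) auto
    finally show "N (W \<tau> n *\<^sub>v (c \<cdot>\<^sub>v x)) \<le> g ^ n * (\<bar>c\<bar> * ?Q x)" by (simp add: mult_ac)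
  qed
  \<comment> \<open>The reverse inequality comes from \<open>smult_le\<close> with the scalar 1 / c;
    for c = 0 nonnegativity settles it.\<close>
  have smult: "?Q (c \<cdot>\<^sub>v x) = \<bar>c\<bar> * ?Q x" if x: "x \<in> carrier_vec d" for c x
  proof (cases "c = 0")
    case True
    have "0 \<le> N (c \<cdot>\<^sub>v x)" using seminorm_nonneg[OF q] x by simp
    also have "\<dots> \<le> ?Q (c \<cdot>\<^sub>v x)" using norm_le_path_norm[OF \<sigma>] x by simp
    finally show ?thesis using smult_le[OF x, of c] True by simp
  next
    case False
    have "(1 / c) \<cdot>\<^sub>v (c \<cdot>\<^sub>v x) = x" using False by (intro eq_vecI) auto
    then have "?Q x \<le> \<bar>1 / c\<bar> * ?Q (c \<cdot>\<^sub>v x)" using smult_le[of "c \<cdot>\<^sub>v x" "1 / c"] x by simp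
    then have "\<bar>c\<bar> * ?Q x \<le> ?Q (c \<cdot>\<^sub>v x)" using False by (simp add: pos_le_divide_eq mult.commute)
    then show ?thesis using smult_le[OF x, of c] by simp
  qed
  have "?Q (x + y) \<le> ?Q x + ?Q y" if x: "x \<in> carrier_vec d" and y: "y \<in> carrier_vec d" for x y
  proof (rule path_norm_least[OF \<sigma>])
    fix \<tau> n assume \<tau>: "\<tau> \<in> adm" "\<tau> 1 = \<sigma> 1"
    have "N (W \<tau> n *\<^sub>v (x + y)) \<le> N (W \<tau> n *\<^sub>v x) + N (W \<tau> n *\<^sub>v y)"
      using seminorm_add[OF seminorm_on_mult_mat_vec[OF q W_carrier[OF \<tau>(1)]] x y] .
    also have "\<dots> \<le> g ^ n * ?Q x + g ^ n * ?Q y"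
      using path_norm_upper[OF \<tau>(1) x, of n] path_norm_upper[OF \<tau>(1) y, of n] \<tau>(2) by simp
    finally show "N (W \<tau> n *\<^sub>v (x + y)) \<le> g ^ n * (?Q x + ?Q y)" by (simp add: distrib_left)
  qed
  with smult show ?thesis unfolding seminorm_on_def by blast
qed

text \<open>Any continuation from the state reached can be prefixed by the first \<open>m\<close>
  letters of \<open>\<sigma>\<close>, and the longer path already occurs in the supremum at the
  starting state.\<close>

lemma path_norm_step:
  assumes \<sigma>: "\<sigma> \<in> adm" and x: "x \<in> carrier_vec d"
  shows "path_norm g (\<sigma> (m + 1)) (W \<sigma> m *\<^sub>v x) \<le> g ^ m * path_norm g (\<sigma> 1) x"
proof -
  have "path_norm g ((\<lambda>i. \<sigma> (i + m)) 1) (W \<sigma> m *\<^sub>v x) \<le> g ^ m * path_norm g (\<sigma> 1) x"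
  proof (rule path_norm_least[OF adm_shift[OF \<sigma>]])
    fix \<tau> n assume \<tau>: "\<tau> \<in> adm" "\<tau> 1 = \<sigma> (1 + m)"
    let ?\<pi> = "\<lambda>i. if i \<le> m then \<sigma> i else \<tau> (i - m)"
    have \<pi>: "?\<pi> \<in> adm" using \<tau> by (intro adm_append \<sigma>) auto
    have pre: "W ?\<pi> m = W \<sigma> m" by (rule word_prod_cong) simp
    have suf: "W (\<lambda>i. ?\<pi> (i + m)) n = W \<tau> n" by (rule word_prod_cong) auto
    have first: "?\<pi> 1 = \<sigma> 1"
      using \<tau>(2) by (cases "m = 0") auto
    have "W \<tau> n *\<^sub>v (W \<sigma> m *\<^sub>v x) = W ?\<pi> (m + n) *\<^sub>v x"
      unfolding W_add_vec[OF \<pi> x] pre suf ..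
    also have "N \<dots> \<le> g ^ (m + n) * path_norm g (\<sigma> 1) x"
      using path_norm_upper[OF \<pi> x, of "m + n"] unfolding first .
    finally show "N (W \<tau> n *\<^sub>v (W \<sigma> m *\<^sub>v x)) \<le> g ^ n * (g ^ m * path_norm g (\<sigma> 1) x)"
      by (simp add: power_add mult_ac)
  qed
  then show ?thesis by (simp add: add.commute)
qed

text \<open>Otherwise blocks of length \<open>n\<close> would all contract by \<open>L\<^sup>n / 2\<close>, against the growth rate being \<open>L\<close>.\<close>

lemma path_norm_slow_decay:
  assumes ne: "adm \<noteq> {}" and L: "0 < L" "\<And>n. L ^ n \<le> growth n"
  obtains \<sigma> x where "\<sigma> \<in> adm" "x \<in> carrier_vec d"
    "L ^ n / 2 * path_norm g (\<sigma> 1) x < path_norm g (\<sigma> (n + 1)) (W \<sigma> n *\<^sub>v x)"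
proof -
  have "\<exists>\<sigma>\<in>adm. \<exists>x\<in>carrier_vec d.
    L ^ n / 2 * path_norm g (\<sigma> 1) x < path_norm g (\<sigma> (n + 1)) (W \<sigma> n *\<^sub>v x)"
  proof (rule ccontr)
    assume "\<not> ?thesis"
    then have contr: "path_norm g (\<sigma> (n + 1)) (W \<sigma> n *\<^sub>v x) \<le> L ^ n / 2 * path_norm g (\<sigma> 1) x"
      if "\<sigma> \<in> adm" "x \<in> carrier_vec d" for \<sigma> x using that by (meson not_le)
    define \<theta> where "\<theta> = L ^ n / 2"
    have \<theta>: "0 \<le> \<theta>" using L by (simp add: \<theta>_def)
    have iter: "path_norm g (\<sigma> (n * k + 1)) (W \<sigma> (n * k) *\<^sub>v x) \<le> \<theta> ^ k * path_norm g (\<sigma> 1) x"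
      if \<sigma>: "\<sigma> \<in> adm" and x: "x \<in> carrier_vec d" for \<sigma> x k
    proof (induction k)
      case 0
      show ?case using x by simp
    next
      case (Suc k)
      have Wx: "W \<sigma> (n * k) *\<^sub>v x \<in> carrier_vec d"
          using W_carrier[OF \<sigma>, of "n * k"] x by simp
      have "path_norm g (\<sigma> (n * Suc k + 1)) (W \<sigma> (n * Suc k) *\<^sub>v x)
          = path_norm g (\<sigma> (n + 1 + n * k)) (W (\<lambda>i. \<sigma> (i + n * k)) n *\<^sub>v (W \<sigma> (n * k) *\<^sub>v x))"
        using W_add_vec[OF \<sigma> x, of "n * k" n] by (simp add: add_ac)
      also have "\<dots> \<le> \<theta> * path_norm g (\<sigma> (1 + n * k)) (W \<sigma> (n * k) *\<^sub>v x)"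
        using contr[OF adm_shift[OF \<sigma>, of "n * k"] Wx] by (simp add: \<theta>_def)
      also have "\<dots> \<le> \<theta> * (\<theta> ^ k * path_norm g (\<sigma> 1) x)"
        using Suc \<theta> by (intro mult_left_mono) (auto simp: add.commute)
      finally show ?case by simp
    qed
    \<comment> \<open>After \<open>k\<close> blocks all norms are at most C * (L ^ n / 2) ^ k, while
      the growth at n k is at least L ^ (n k).\<close>
    have "2 ^ k \<le> C" for k :: nat
    proof -
      have "growth (n * k) \<le> C * \<theta> ^ k"
      proof (rule growth_least[OF ne], rule induced_norm_least[OF d N])
        fix \<sigma> and x :: "real vec" assume \<sigma>: "\<sigma> \<in> adm" and x: "x \<in> carrier_vec d"
        have Wx: "W \<sigma> (n * k) *\<^sub>v x \<in> carrier_vec d"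
          using W_carrier[OF \<sigma>, of "n * k"] x by simp
        have "N (W \<sigma> (n * k) *\<^sub>v x) \<le> path_norm g (\<sigma> (n * k + 1)) (W \<sigma> (n * k) *\<^sub>v x)"
          using norm_le_path_norm[OF adm_shift[OF \<sigma>, of "n * k"] Wx] by (simp add: add.commute)
        also have "\<dots> \<le> \<theta> ^ k * path_norm g (\<sigma> 1) x" by (rule iter[OF \<sigma> x])
        also have "\<dots> \<le> \<theta> ^ k * (C * N x)"
          using path_norm_le[OF \<sigma> x] \<theta> by (intro mult_left_mono) auto
        finally show "N (W \<sigma> (n * k) *\<^sub>v x) \<le> C * \<theta> ^ k * N x" by (simp add: mult_ac)
      qed
      then have "L ^ (n * k) \<le> C * \<theta> ^ k" using L(2)[of "n * k"] by linarith
      also have "\<dots> = C / 2 ^ k * L ^ (n * k)"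
        by (simp add: \<theta>_def power_divide power_mult)
      finally have le: "L ^ (n * k) \<le> C / 2 ^ k * L ^ (n * k)" .
      have "1 \<le> C / 2 ^ k"
        by (rule mult_right_le_imp_le[of _ "L ^ (n * k)"]) (use le L(1) in simp_all)
      then show ?thesis by (simp add: pos_le_divide_eq)
    qed
    moreover obtain k :: nat where "C < 2 ^ k" using real_arch_pow[of 2 C] by auto
    ultimately show False by (meson not_le)
  qed
  then show ?thesis using that by blast
qed

end

text \<open>A path \<open>x\<^sub>0, x\<^sub>1, \<dots>\<close> whose rescaled norms stay between \<open>1/4\<close> and \<open>2\<close> for long enough nearly returns to the same vector in the same state; the loop in between almost fixes that vector.\<close>

lemma loop_with_large_spectral_radius:
  assumes ne: "adm \<noteq> {}" and L: "0 < L" "\<And>n. L ^ n \<le> growth n"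
    and lim: "(\<lambda>n. root n (growth n)) \<longlonglongrightarrow> L" and \<eta>: "0 < \<eta>"
  obtains \<tau> p where "\<tau> \<in> adm" "1 \<le> p" "\<tau> (p + 1) = \<tau> 1"
    "(1 - \<eta>) * L ^ p < real_spectral_radius (W \<tau> p)"
proof -
  \<comment> \<open>Makes 2 ^ (2 * d + 1) * \<epsilon> equal to \<eta> ^ d / 4, where 1 / 4 is the
    lower bound \<open>y_ge\<close> for the norms along the path.\<close>
  define \<epsilon> where "\<epsilon> = \<eta> ^ d / (4 * 2 ^ (2 * d + 1))"
  have \<epsilon>: "0 < \<epsilon>" using \<eta> by (simp add: \<epsilon>_def)
  obtain M where M: "\<forall>q (X :: nat set) x. seminorm_on d q \<longrightarrow> finite X \<longrightarrow> M < card X \<longrightarrow>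
    (\<forall>k\<in>X. x k \<in> carrier_vec d \<and> q (x k) \<le> 2) \<longrightarrow>
    (\<exists>j\<in>X. \<exists>k\<in>X. j \<noteq> k \<and> q (x j - x k) \<le> \<epsilon>)"
    using seminorm_balls_uniformly_totally_bounded[OF \<epsilon>, of 2 d] by auto
  \<comment> \<open>There are more than K * M times 0, ..., n, so one of the K states is visited at
    more than \<open>M\<close> of them.\<close>
  define n where "n = K * M + 1"
  \<comment> \<open>\<open>g = L * h\<close> is so close to \<open>L\<close> that \<open>n\<close>
    steps cost only a factor 2 beyond L ^ n. Since \<open>M\<close> is uniform in the seminorm,
    \<open>n\<close> can be fixed before \<open>g\<close> and hence before the norms
    \<open>?Q\<close>.\<close>
  define h where "h = root n 2"
  have "0 < n" by (simp add: n_def)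
  then have h: "1 < h" "h ^ n = 2" using real_root_pow_pos2[of n 2] by (simp_all add: h_def)
  have h_le: "h ^ k \<le> 2" if "k \<le> n" for k
    using power_increasing[OF that, of h] h by simp
  define g where "g = L * h"
  have g: "0 < g" "L < g" using L h by (simp_all add: g_def)
  have "\<forall>\<^sub>F m in sequentially. root m (growth m) < g" using order_tendstoD(2)[OF lim g(2)] .
  then obtain m where m: "1 \<le> m" "root m (growth m) < g"
    unfolding eventually_sequentially by (metis max.cobounded1 max.cobounded2)
  obtain C where C: "\<And>n. growth n \<le> C * g ^ n"
    using submultiplicative_exponential_bound[OF growth_nonneg[OF ne] growth_submult[OF ne] m] by blast
  let ?Q = "path_norm g"
  obtain \<sigma> x where \<sigma>: "\<sigma> \<in> adm" and x: "x \<in> carrier_vec d"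
    and slow: "L ^ n / 2 * ?Q (\<sigma> 1) x < ?Q (\<sigma> (n + 1)) (W \<sigma> n *\<^sub>v x)"
    using path_norm_slow_decay[OF g(1) C ne L] by blast
  have Q: "seminorm_on d (?Q (\<sigma> (k + 1)))" for k
    using seminorm_on_path_norm[OF g(1) C adm_shift[OF \<sigma>, of k]] by (simp add: add.commute)
  define X where "X k = W \<sigma> k *\<^sub>v x" for k
  have Xc: "X k \<in> carrier_vec d" for k using W_carrier[OF \<sigma>, of k] x by (simp add: X_def)
  define q0 where "q0 = ?Q (\<sigma> 1) x"
  have up: "?Q (\<sigma> (k + 1)) (X k) \<le> g ^ k * q0" for k
    unfolding X_def q0_def by (rule path_norm_step[OF g(1) C \<sigma> x])
  have X_add: "X (j + k) = W (\<lambda>i. \<sigma> (i + j)) k *\<^sub>v X j" for j k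
    unfolding X_def by (rule W_add_vec[OF \<sigma> x])
  have q0: "0 < q0"
  proof -
    have "0 \<le> q0" using seminorm_nonneg[OF Q[of 0] x] by (simp add: q0_def)
    moreover have "q0 \<noteq> 0" using slow up[of n] by (auto simp: q0_def X_def)
    ultimately show ?thesis by simp
  qed
  define y where "y k = (1 / (L ^ k * q0)) \<cdot>\<^sub>v X k" for k
  have yc: "y k \<in> carrier_vec d" for k using Xc by (simp add: y_def)
  have Qy: "?Q (\<sigma> (k + 1)) (y k) = ?Q (\<sigma> (k + 1)) (X k) / (L ^ k * q0)" for k
    using seminorm_smult[OF Q Xc, of k "1 / (L ^ k * q0)"] L q0 by (simp add: y_def)
  have y_le: "?Q (\<sigma> (k + 1)) (y k) \<le> 2" if "k \<le> n" for k
  proof -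
    have "?Q (\<sigma> (k + 1)) (X k) \<le> h ^ k * (L ^ k * q0)"
      using up[of k] by (simp add: g_def power_mult_distrib mult_ac)
    also have "\<dots> \<le> 2 * (L ^ k * q0)"
      using h_le[OF that] L q0 by (intro mult_right_mono) auto
    finally show ?thesis unfolding Qy using L q0 by (simp add: pos_divide_le_eq)
  qed
  \<comment> \<open>From time \<open>k\<close> to time \<open>n\<close> the norm grows by a factor
    of at most 2 * L ^ (n - k), yet more than half of L ^ n * q0 is left at the end.\<close>
  have y_ge: "1 / 4 < ?Q (\<sigma> (k + 1)) (y k)" if k: "k \<le> n" for k
  proof -
    let ?a = "?Q (\<sigma> (k + 1)) (X k)"
    have nn: "0 \<le> ?a" by (rule seminorm_nonneg[OF Q Xc])
    have "?Q (\<sigma> (n + 1)) (X n) \<le> g ^ (n - k) * ?a"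
      using path_norm_step[OF g(1) C adm_shift[OF \<sigma>, of k] Xc, of "n - k" k] X_add[of k "n - k"] k
      by (simp add: add.commute)
    also have "\<dots> = h ^ (n - k) * (L ^ (n - k) * ?a)" by (simp add: g_def power_mult_distrib mult_ac)
    also have "\<dots> \<le> 2 * (L ^ (n - k) * ?a)"
      using h_le[of "n - k"] L nn by (intro mult_right_mono) auto
    finally have "L ^ n / 2 * q0 < 2 * (L ^ (n - k) * ?a)" using slow by (simp add: X_def q0_def)
    moreover have "L ^ n = L ^ (n - k) * L ^ k" using k by (simp flip: power_add)
    ultimately have "L ^ (n - k) * (L ^ k * q0) < L ^ (n - k) * (4 * ?a)" by (simp add: mult_ac)
    then have "L ^ k * q0 < 4 * ?a" using L by (simp add: mult_less_cancel_left_pos)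
    then show ?thesis unfolding Qy using L q0 by (simp add: pos_less_divide_eq)
  qed
  have "(\<lambda>k. \<sigma> (k + 1)) ` {..n} \<subseteq> {1..K}"
    using adm_letter[OF \<sigma>] by (intro image_subsetI) simp
  then obtain b where b: "M < card {k \<in> {..n}. \<sigma> (k + 1) = b}"
    using pigeonhole_fibre[of "{..n}" "{1..K}" "\<lambda>k. \<sigma> (k + 1)" M] by (auto simp: n_def)
  define S where "S = {k \<in> {..n}. \<sigma> (k + 1) = b}"
  have S: "k \<le> n" "\<sigma> (k + 1) = b" if "k \<in> S" for k using that by (auto simp: S_def)
  have "S \<noteq> {}" using b unfolding S_def[symmetric] by (metis card.empty not_less_zero)
  then obtain k0 where "k0 \<in> S" by blast
  then have Qb: "seminorm_on d (?Q b)" using Q[of k0] S by simp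
  have "\<forall>k\<in>S. y k \<in> carrier_vec d \<and> ?Q b (y k) \<le> 2" using y_le S yc by metis
  moreover have "finite S" by (simp add: S_def)
  ultimately obtain i j where "i \<in> S" "j \<in> S" "i \<noteq> j" "?Q b (y i - y j) \<le> \<epsilon>"
    using M Qb b unfolding S_def[symmetric] by blast
  \<comment> \<open>The two times are put in order so that the loop runs forward from
    \<open>j\<close> to \<open>k\<close>.\<close>
  then obtain j k where jk: "j \<in> S" "k \<in> S" "j < k" "?Q b (y k - y j) \<le> \<epsilon>"
    using seminorm_minus_commute[OF Qb yc yc] by (metis nat_neq_iff)
  define p where "p = k - j"
  have k: "k = j + p" and p: "1 \<le> p" "p \<le> n" using jk S(1)[OF jk(2)] by (auto simp: p_def)
  define \<tau> where "\<tau> i = \<sigma> (i + j)" for i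
  have \<tau>: "\<tau> \<in> adm" unfolding \<tau>_def by (rule adm_shift[OF \<sigma>])
  have \<tau>1: "\<tau> 1 = b" using S[OF jk(1)] by (simp add: \<tau>_def add.commute)
  have \<tau>p: "\<tau> (p + 1) = b" using S[OF jk(2)] by (simp add: \<tau>_def k add_ac)
  define B where "B = W \<tau> p"
  \<comment> \<open>With this scaling \<open>P\<close> maps \<open>y j\<close> to \<open>y k\<close>
    and expands the norm at state \<open>b\<close> by at most h ^ p <= 2.\<close>
  define P where "P = (1 / L ^ p) \<cdot>\<^sub>m B"
  have B: "B \<in> carrier_mat d d" unfolding B_def by (rule W_carrier[OF \<tau>])
  then have P: "P \<in> carrier_mat d d" by (simp add: P_def)
  have Pz: "P *\<^sub>v z = (1 / L ^ p) \<cdot>\<^sub>v (B *\<^sub>v z)" if "z \<in> carrier_vec d" for z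
    using B that by (intro eq_vecI) (auto simp: P_def scalar_prod_def sum_distrib_left mult.assoc)
  have "1 - \<eta> < real_spectral_radius P"
  proof (rule almost_fixed_imp_spectral_radius_gt[OF P Qb yc[of j]])
    fix z :: "real vec" assume z: "z \<in> carrier_vec d"
    have Bz: "B *\<^sub>v z \<in> carrier_vec d" using B z by simp
    have "?Q b (P *\<^sub>v z) = ?Q b (B *\<^sub>v z) / L ^ p"
      using seminorm_smult[OF Qb Bz, of "1 / L ^ p"] L by (simp add: Pz[OF z])
    also have "\<dots> \<le> h ^ p * ?Q b z"
      using path_norm_step[OF g(1) C \<tau> z, of p] L
      by (simp add: \<tau>1[simplified] \<tau>p[simplified] B_def g_def power_mult_distrib pos_divide_le_eq mult_ac)
    also have "\<dots> \<le> 2 * ?Q b z"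
      using h_le[OF p(2)] seminorm_nonneg[OF Qb z] by (rule mult_right_mono)
    finally show "?Q b (P *\<^sub>v z) \<le> 2 * ?Q b z" .
  next
    have "B *\<^sub>v X j = X k" using X_add[of j p] by (simp add: B_def \<tau>_def[abs_def] k)
    moreover have "B *\<^sub>v y j = (1 / (L ^ j * q0)) \<cdot>\<^sub>v (B *\<^sub>v X j)"
      unfolding y_def by (rule mult_mat_vec[OF B Xc])
    ultimately have "P *\<^sub>v y j = y k"
      unfolding Pz[OF yc] by (simp add: y_def k smult_smult_assoc power_add mult_ac)
    then show "?Q b (P *\<^sub>v y j - y j) \<le> \<epsilon>" using jk(4) by simp
    have "2 ^ (2 * d + 1) * \<epsilon> = \<eta> ^ d * (1 / 4)" by (simp add: \<epsilon>_def)
    also have "\<dots> < \<eta> ^ d * ?Q b (y j)"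
      using y_ge[of j] S[OF jk(1)] \<eta> by (intro mult_strict_left_mono) auto
    finally show "2 ^ (2 * d + 1) * \<epsilon> < \<eta> ^ d * ?Q b (y j)" .
  qed (use \<eta> in simp)
  also have "\<dots> \<le> (1 / L ^ p) * real_spectral_radius B"
    unfolding P_def using d L by (intro real_spectral_radius_smult_le[OF B]) auto
  finally have "(1 - \<eta>) * L ^ p < real_spectral_radius (W \<tau> p)"
    using L by (simp add: B_def pos_less_divide_eq)
  with that \<tau> p(1) \<tau>1 \<tau>p show ?thesis by metis
qed

section \<open>The lower bound for the limsup and the conclusion\<close>

text \<open>The limsup requires arbitrarily long words. Repetitions of a single loop supply them,
  since powers of an eigenvalue are eigenvalues of the powers.\<close>

lemma le_limsup_max_spectral:
  assumes \<tau>: "\<tau> \<in> adm" "1 \<le> p" "\<tau> (p + 1) = \<tau> 1"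
    and c: "0 \<le> c" "c ^ p \<le> real_spectral_radius (W \<tau> p)"
  shows "ereal c \<le> limsup (\<lambda>n. ereal (max_spectral d K A T n))"
proof -
  define w where "w = restrict \<tau> {1..p}"
  have w: "w \<in> periodic_words K T p" unfolding w_def by (rule periodic_wordI[OF \<tau>])
  have Ww: "W w p = W \<tau> p" unfolding w_def by (rule word_prod_cong) simp
  \<comment> \<open>After place p + 1 the sequence \<open>\<tau>\<close> may leave the loop, so the
    periodic extension of its first \<open>p\<close> letters replaces it.\<close>
  obtain \<sigma> where \<sigma>: "\<sigma> \<in> adm" "\<And>i. 1 \<le> i \<Longrightarrow> \<sigma> (i + p) = \<sigma> i" "W \<sigma> p = W w p"
    using periodic_word_extension[OF w \<tau>(2)] by metis
  have B: "W \<tau> p \<in> carrier_mat d d" by (rule W_carrier[OF \<tau>(1)])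
  have "0 < d" using d by simp
  from real_spectral_radius_attained[OF B this] obtain a where
    a: "eigenvalue (map_mat complex_of_real (W \<tau> p)) a" "norm a = real_spectral_radius (W \<tau> p)" .
  define r where "r k = p * Suc k" for k
  have "c \<le> max_spectral d K A T (r k)" for k
  proof -
    have rk: "1 \<le> r k" using \<tau>(2) by (simp add: r_def)
    have per: "\<sigma> (i + p * l) = \<sigma> i" if "1 \<le> i" for i l
    proof (induction l)
      case (Suc l)
      have "\<sigma> (i + p * Suc l) = \<sigma> (i + p * l + p)" by (simp add: add_ac)
      also have "\<dots> = \<sigma> (i + p * l)" using that by (intro \<sigma>(2)) simp
      finally show ?case using Suc by simp
    qed simp
    have u: "restrict \<sigma> {1..r k} \<in> periodic_words K T (r k)"
      using per[of 1 "Suc k"] by (intro periodic_wordI \<sigma>(1) rk) (simp add: r_def add.commute)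
    have "W (restrict \<sigma> {1..r k}) (r k) = W \<sigma> (r k)" by (rule word_prod_cong) simp
    also have "\<dots> = W \<tau> p ^\<^sub>m Suc k"
      using W_periodic_power[OF \<sigma>(1,2), of "Suc k"] by (simp only: r_def \<sigma>(3) Ww)
    finally have Wu: "W (restrict \<sigma> {1..r k}) (r k) = W \<tau> p ^\<^sub>m Suc k" .
    have "c ^ r k = (c ^ p) ^ Suc k" unfolding r_def by (rule power_mult)
    also have "\<dots> \<le> norm a ^ Suc k" using c a(2) by (intro power_mono) auto
    also have "\<dots> = norm (a ^ Suc k)" by (simp only: norm_power)
    also have "\<dots> \<le> real_spectral_radius (W \<tau> p ^\<^sub>m Suc k)"
      by (rule real_spectral_radius_ge[OF pow_carrier_mat[OF B] eigenvalue_pow[OF B a(1)]])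
    finally have "root (r k) (c ^ r k) \<le> root (r k) (real_spectral_radius (W \<tau> p ^\<^sub>m Suc k))"
      using rk by (intro real_root_le_mono) auto
    then show ?thesis
      using max_spectral_upper[OF u] rk c(1) unfolding Wu by (simp add: real_root_power_cancel)
  qed
  then have "ereal c \<le> limsup ((\<lambda>n. ereal (max_spectral d K A T n)) \<circ> r)"
    by (intro le_Limsup) auto
  also have "\<dots> \<le> limsup (\<lambda>n. ereal (max_spectral d K A T n))"
    using \<tau>(2) by (intro limsup_subseq_mono) (auto simp: strict_mono_def r_def)
  finally show ?thesis .
qed

theorem markov_berger_wang:
  "\<exists>L::real. (\<lambda>n. max_norm d N K A T n) \<longlonglongrightarrow> L \<and>
     limsup (\<lambda>n. ereal (max_spectral d K A T n)) = ereal L"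
proof (cases "adm = {}")
  \<comment> \<open>Without admissible sequences there are no periodic words of positive length
    either, and both sides are 0.\<close>
  case True
  have "markov_seqs K T = {}"
    using image_markov_seqs[of "\<lambda>B. B" 0] unfolding True by simp
  then have "max_norm d N K A T n = 0" for n by (simp add: max_norm_def max_or_0_def)
  moreover have "periodic_words K T n = {}" if "1 \<le> n" for n
    using periodic_word_extension[OF _ that] unfolding True by blast
  then have "\<forall>\<^sub>F n in sequentially. ereal (max_spectral d K A T n) = ereal 0"
    by (intro eventually_sequentiallyI[of 1]) (simp add: max_spectral_def max_or_0_def)
  then have "limsup (\<lambda>n. ereal (max_spectral d K A T n)) = ereal 0"
    by (intro lim_imp_Limsup tendsto_eventually) auto
  ultimately show ?thesis by (intro exI[of _ 0]) simp
next
  case ne: False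
  obtain L where L: "0 \<le> L" "(\<lambda>n. root n (growth n)) \<longlonglongrightarrow> L"
    and L_le: "\<And>n. 1 \<le> n \<Longrightarrow> L \<le> root n (growth n)"
    using submultiplicative_root_converges[OF growth_nonneg[OF ne] growth_submult[OF ne]] by blast
  have "\<forall>\<^sub>F n in sequentially. root n (growth n) = max_norm d N K A T n"
    by (intro eventually_sequentiallyI[of 1]) (simp add: max_norm_eq_root_growth[OF ne])
  then have lim: "(\<lambda>n. max_norm d N K A T n) \<longlonglongrightarrow> L"
    using L(2) by (rule Lim_transform_eventually[rotated])
  let ?S = "limsup (\<lambda>n. ereal (max_spectral d K A T n))"
  have le: "?S \<le> ereal L"
    by (intro Limsup_bounded eventually_sequentiallyI[of 1])
      (simp add: max_spectral_le_limit[OF L(2,1)])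
  \<comment> \<open>With \<eta> = 1 - z a loop of length \<open>p\<close> gives z * L ^ p, and this
    is at least (z * L) ^ p because p >= 1. The value \<open>L\<close> itself is reached by letting
    z tend to 1.\<close>
  have ge: "ereal (z * L) \<le> ?S" if z: "0 < z" "z < 1" for z
  proof (cases "L = 0")
    case True
    then show ?thesis using max_spectral_nonneg by (intro le_Limsup) auto
  next
    case False
    with L have Lpos: "0 < L" by simp
    have L_growth: "L ^ n \<le> growth n" for n
    proof (cases "n = 0")
      case True
      obtain \<sigma> where \<sigma>: "\<sigma> \<in> adm" using ne by blast
      obtain v where v: "v \<in> carrier_vec d" "N v = 1" using unit_sphere_nonempty[OF d N] by auto
      have "1 \<le> induced_norm d N (W \<sigma> 0)"
        using induced_norm_upper[OF d N W_carrier[OF \<sigma>, of 0] v(1)] v by simp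
      then show ?thesis using growth_upper[OF \<sigma>, of 0] True by simp
    next
      case False
      then have "L ^ n \<le> root n (growth n) ^ n" using L L_le by (intro power_mono) auto
      then show ?thesis using False growth_nonneg[OF ne] by simp
    qed
    obtain \<tau> p where \<tau>: "\<tau> \<in> adm" "1 \<le> p" "\<tau> (p + 1) = \<tau> 1"
      and \<rho>: "(1 - (1 - z)) * L ^ p < real_spectral_radius (W \<tau> p)"
      using loop_with_large_spectral_radius[OF ne Lpos L_growth L(2), of "1 - z"] z by auto
    have "z ^ p \<le> z ^ 1" using z \<tau>(2) by (intro power_decreasing) auto
    then have "(z * L) ^ p \<le> z * L ^ p" using Lpos by (simp add: power_mult_distrib mult_right_mono)
    with \<rho> show ?thesis using z Lpos by (intro le_limsup_max_spectral[OF \<tau>]) auto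
  qed
  \<comment> \<open>One instance of \<open>ge\<close>, together with \<open>le\<close>, shows that
    the limsup is a real number.\<close>
  have "ereal (1 / 2 * L) \<le> ?S" by (rule ge) auto
  with le obtain r where r: "?S = ereal r" by (cases ?S) auto
  have "L \<le> r"
    by (rule field_le_mult_one_interval) (use ge in \<open>auto simp: r\<close>)
  with le have "?S = ereal L" by (simp add: r)
  with lim show ?thesis by blast
qed

end

theorem theorem1p4:
  fixes d K :: nat
    and N :: "real vec \<Rightarrow> real"
    and A :: "nat \<Rightarrow> real mat"
    and T :: "nat \<Rightarrow> nat \<Rightarrow> nat"
  assumes "d \<ge> 1" and "K \<ge> 2"
    and "vec_norm_on d N"
    and "\<And>i. i \<in> {1..K} \<Longrightarrow> A i \<in> carrier_mat d d"
    and "zero_one_matrix K T"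
  shows "\<exists>L::real.
           (\<lambda>n. max_norm d N K A T n) \<longlonglongrightarrow> L \<and>
           limsup (\<lambda>n. ereal (max_spectral d K A T n)) = ereal L"
proof -
  interpret markov_products d K N A T
    using assms(1,3,4) by unfold_locales
  show ?thesis by (rule markov_berger_wang)
qed

end
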